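(* Let $H=(C,E)$ be any fixed connected graph, and let $q=|C|$. Put $s=4q+1$, $\beta=\lceil\log(2sq^s+1)\rceil q^s$ and $l_2=2\beta s$. For any integer $n$ (the number of sites of the path) consider the $m_2+1=\lfloor 2n/l_2\rfloor$ blocks $\Theta_0,\dots,\Theta_{m_2}$ given by $$\Theta_k=\{k\beta s+1,\dots,\min((k+2)\beta s,n)\},$$ and let $\mathcal{M}_{\mathrm{FixedOrder}}$ be the systematic scan Markov chain, on the state space $\Omega_\sim$, one step (scan) of which performs a heat-bath move on each block in the order $\Theta_0,\dots,\Theta_{m_2}$. The mixing time of $\mathcal{M}_{\mathrm{FixedOrder}}$, as a function of the deviation $\epsilon$ from stationarity, satisfies $$\mathrm{Mix}(\mathcal{M}_{\mathrm{FixedOrder}},\epsilon)\le(4sq^s+2)\log(n\epsilon^{-1})$$ scans of the $n$-vertex path. This corresponds to $O(n\log n)$ updates by the construction of the set of blocks.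
   Context: $H=(C,E)$ is a finite undirected graph, loops allowed; elements of $C$ are called colours. $\log$ is the natural logarithm. The $n$-vertex path has site set $V=\{1,\dots,n\}$ and edges $\{i,i+1\}$, $1\le i<n$. An $H$-colouring of the path is a function $h:V\to C$ with $(h(i),h(i+1))\in E$ for all $1\le i<n$; $\Omega$ is the set of all $H$-colourings. The state space $\Omega_\sim$ is: $\Omega_\sim=\Omega$ if $H$ is not bipartite; if $H$ is bipartite with colour classes $C_1,C_2$, then $\Omega_\sim$ is one of $\Omega_1=\{x\in\Omega:x_1\in C_1\}$ and $\Omega_2=\{x\in\Omega:x_1\in C_2\}$. A configuration is any function $V\to C$. A heat-bath move on $\Lambda\subseteq V$ from a configuration $x$ draws a new configuration uniformly from $\Omega_\Lambda(x)$, the set of configurations that agree with $x$ on $V\setminus\Lambda$ and in which, for every edge of the path containing a site of $\Lambda$, the colours assigned to its endpoints are adjacent in $H$; the move is a transition within the state space $\Omega_\sim$. For a Markov chain $\mathcal{M}$ with state space $\Omega_\sim$, transition matrix $P$ and stationary distribution $\pi$ (here uniform on $\Omega_\sim$), $\mathrm{Mix}(\mathcal{M},\epsilon)=\max_{x\in\Omega_\sim}\min\{t>0: d_{\mathrm{TV}}(P^t(x,\cdot),\pi)\le\epsilon\}$, where $d_{\mathrm{TV}}(\theta_1,\theta_2)=\frac12\sum_i|\theta_1(i)-\theta_2(i)|$.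
   Formalization: The bound is proved when there is at least one block (n ≥ βs) and 0 < ε ≤ 1; with no block a scan changes nothing and the chain need not mix, and for ε ≥ n the bound is not positive while the mixing time is at least 1. *)

theory Defs
  imports
    "HOL-Probability.Probability"
    "HOL-Library.Landau_Symbols"
    "HOL-Library.Extended_Nat"
    "Graph_Theory.Digraph_Component"
    "Graph_Theory.Pair_Digraph"
begin

text \<open>
  A finite undirected graph with loops allowed is a symmetric finite digraph given by
  its set of arcs, i.e. a \<^typ>\<open>'c pair_pre_digraph\<close> satisfying \<^const>\<open>pair_pseudo_graph\<close>.
\<close>

definition bipartition :: "'c pair_pre_digraph \<Rightarrow> 'c set \<Rightarrow> 'c set \<Rightarrow> bool" where
  "bipartition H C1 C2 \<longleftrightarrow>
     C1 \<union> C2 = pverts H \<and> C1 \<inter> C2 = {} \<and>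
     (\<forall>(u, v) \<in> parcs H. (u \<in> C1 \<and> v \<in> C2) \<or> (u \<in> C2 \<and> v \<in> C1))"

definition bipartite :: "'c pair_pre_digraph \<Rightarrow> bool" where
  "bipartite H \<longleftrightarrow> (\<exists>C1 C2. bipartition H C1 C2)"

text \<open>
  Configurations of the path with site set \<open>{1..n}\<close> are extensional functions, so that
  two configurations are equal iff they agree on all sites.
\<close>

definition configurations :: "'c pair_pre_digraph \<Rightarrow> nat \<Rightarrow> (nat \<Rightarrow> 'c) set" where
  "configurations H n = {1..n} \<rightarrow>\<^sub>E pverts H"

definition colourings :: "'c pair_pre_digraph \<Rightarrow> nat \<Rightarrow> (nat \<Rightarrow> 'c) set" where
  "colourings H n =
     {h \<in> configurations H n. \<forall>i. 1 \<le> i \<and> i < n \<longrightarrow> (h i, h (i + 1)) \<in> parcs H}"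

definition is_state_space ::
  "'c pair_pre_digraph \<Rightarrow> nat \<Rightarrow> (nat \<Rightarrow> 'c) set \<Rightarrow> bool" where
  "is_state_space H n S \<longleftrightarrow>
     (if bipartite H
      then \<exists>C1 C2. bipartition H C1 C2 \<and>
             (S = {x \<in> colourings H n. x 1 \<in> C1} \<or> S = {x \<in> colourings H n. x 1 \<in> C2})
      else S = colourings H n)"

definition heat_bath_set ::
  "'c pair_pre_digraph \<Rightarrow> nat \<Rightarrow> nat set \<Rightarrow> (nat \<Rightarrow> 'c) \<Rightarrow> (nat \<Rightarrow> 'c) set" where
  "heat_bath_set H n \<Lambda> x =
     {y \<in> configurations H n.
        (\<forall>i \<in> {1..n} - \<Lambda>. y i = x i) \<and>
        (\<forall>i. 1 \<le> i \<and> i < n \<and> (i \<in> \<Lambda> \<or> i + 1 \<in> \<Lambda>) \<longrightarrow> (y i, y (i + 1)) \<in> parcs H)}"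

text \<open>
  The intersection with the state space \<open>S\<close> only matters when \<open>\<Lambda>\<close> is the whole path and
  \<open>H\<close> is bipartite: if \<open>\<Lambda>\<close> leaves a site fixed and \<open>x \<in> S\<close>, every element of
  \<open>heat_bath_set H n \<Lambda> x\<close> already lies in \<open>S\<close>.  The kernel is meaningful for \<open>x \<in> S\<close> only;
  then the set drawn from contains \<open>x\<close>, and the chain never leaves \<open>S\<close>.
\<close>

definition heat_bath ::
  "'c pair_pre_digraph \<Rightarrow> nat \<Rightarrow> (nat \<Rightarrow> 'c) set \<Rightarrow> nat set \<Rightarrow> (nat \<Rightarrow> 'c) \<Rightarrow> (nat \<Rightarrow> 'c) pmf" where
  "heat_bath H n S \<Lambda> x = pmf_of_set (heat_bath_set H n \<Lambda> x \<inter> S)"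

primrec systematic_scan ::
  "'c pair_pre_digraph \<Rightarrow> nat \<Rightarrow> (nat \<Rightarrow> 'c) set \<Rightarrow> nat set list \<Rightarrow> (nat \<Rightarrow> 'c) \<Rightarrow> (nat \<Rightarrow> 'c) pmf"
where
  "systematic_scan H n S [] x = return_pmf x"
| "systematic_scan H n S (\<Lambda> # \<Lambda>s) x =
     bind_pmf (heat_bath H n S \<Lambda> x) (systematic_scan H n S \<Lambda>s)"

text \<open>A transition matrix is given as a kernel: \<open>P(x, y) = pmf (K x) y\<close>.\<close>

definition kernel_power :: "('s \<Rightarrow> 's pmf) \<Rightarrow> nat \<Rightarrow> 's \<Rightarrow> 's pmf" where
  "kernel_power K t x = ((\<lambda>\<mu>. bind_pmf \<mu> K) ^^ t) (return_pmf x)"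

definition tv_dist :: "'s set \<Rightarrow> 's pmf \<Rightarrow> 's pmf \<Rightarrow> real" where
  "tv_dist S \<theta>1 \<theta>2 = 1 / 2 * (\<Sum>i\<in>S. \<bar>pmf \<theta>1 i - pmf \<theta>2 i\<bar>)"

text \<open>
  The value is \<open>\<infinity>\<close> if from some initial state the distance never drops to \<open>\<epsilon>\<close>.
\<close>

definition mixing_time :: "'s set \<Rightarrow> ('s \<Rightarrow> 's pmf) \<Rightarrow> 's pmf \<Rightarrow> real \<Rightarrow> enat" where
  "mixing_time S K \<pi> \<epsilon> =
     (SUP x\<in>S. INF t\<in>{t. 0 < t \<and> tv_dist S (kernel_power K t x) \<pi> \<le> \<epsilon>}. enat t)"

definition block :: "nat \<Rightarrow> nat \<Rightarrow> nat \<Rightarrow> nat \<Rightarrow> nat set" where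
  "block \<beta> s n k = {k * \<beta> * s + 1 .. min ((k + 2) * \<beta> * s) n}"

definition fixed_order ::
  "'c pair_pre_digraph \<Rightarrow> nat \<Rightarrow> (nat \<Rightarrow> 'c) set \<Rightarrow> nat \<Rightarrow> nat \<Rightarrow> nat \<Rightarrow> (nat \<Rightarrow> 'c) \<Rightarrow> (nat \<Rightarrow> 'c) pmf"
where
  "fixed_order H n S \<beta> s m = systematic_scan H n S (map (block \<beta> s n) [0..<m])"

definition fixed_order_mix ::
  "'c pair_pre_digraph \<Rightarrow> nat \<Rightarrow> (nat \<Rightarrow> 'c) set \<Rightarrow> nat \<Rightarrow> nat \<Rightarrow> nat \<Rightarrow> real \<Rightarrow> enat" where
  "fixed_order_mix H n S \<beta> s m \<epsilon> =
     mixing_time S (fixed_order H n S \<beta> s m) (pmf_of_set S) \<epsilon>"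

end

(*
  Couple two copies of the chain and track the probability of disagreement at each site.
  A heat-bath move on a block depends on its surroundings only through the colours at its two
  boundary sites.  Since s exceeds twice the number of colours, walks of length s join any two
  colours of compatible parity, so revealing a block from one end in segments of s sites lets the
  two copies coalesce with probability at least q^(-s) per segment: a disagreement at one boundary
  site reaches distance beta s with probability at most
  delta = (1 - q^(-s))^beta <= 1 / (2 s q^s + 1).  Two differing boundary sites are treated one
  after the other, through an intermediate configuration that carries one boundary colour of each
  copy and need not be a proper colouring outside the block.
  If every site disagrees with probability at most D before a scan, then during the scan the site
  left of the current block disagrees with probability at most eta D, where
  eta = delta / (1 - delta) solves delta (1 + eta) = eta, and after the scan every site disagrees
  with probability at most (eta + delta) D.  This factor is below 1/e, hence
  log(n / epsilon), rounded up, scans suffice.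
*)
theory Submission
  imports Defs
begin

section \<open>Walks of prescribed length and parity\<close>

text \<open>The factor q^(-s) is a counting bound. Restrict the fillings of a block to the sites
  beyond a segment: walks through the segment can be rerouted, so both copies have the same set of
  restrictions, and each restriction extends in at least one and at most q^s ways. Both restricted
  laws thus dominate q^(-s) times one uniform law, however many colourings the rest of the block
  has. After a failure nothing is known about the copies except parity, and the next segment is
  tried; this is legitimate because redrawing part of a uniform filling does not change its law.

  Rerouting preserves the length of a walk, so parity is the obstacle when H is bipartite. The
  relation \<open>even_linked\<close> is the invariant that deals with it: it holds between two
  states at every site and passes on to colours s sites further along. The threshold 2q is the
  number of vertices of the bipartite double cover, in which a shortest walk has fewer steps than
  that.

  The block length 2 beta s puts the middle site far from both boundary sites, and this middle site
  is the left boundary site of the next block.\<close>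

lemma relpow_symD:
  assumes "sym R" "(u, v) \<in> R ^^ k" shows "(v, u) \<in> R ^^ k"
  using assms(2)
proof (induction k arbitrary: v)
  case (Suc k)
  then obtain w where "(u, w) \<in> R ^^ k" "(w, v) \<in> R" by auto
  with Suc.IH assms(1) show ?case by (meson relpow_Suc_I2 symD)
qed auto

text \<open>A shortest walk repeats no vertex, since the stretch between two visits could be cut
  out; its \<open>m\<close> steps therefore visit \<open>m + 1\<close> different elements of
  \<open>W\<close>.\<close>

lemma relpow_short:
  assumes "finite W" "R \<subseteq> W \<times> W" "u \<in> W" "(u, v) \<in> R ^^ k"
  shows "\<exists>j < card W. (u, v) \<in> R ^^ j"
proof -
  define m where "m = (LEAST m. (u, v) \<in> R ^^ m)"
  have m: "(u, v) \<in> R ^^ m" unfolding m_def using assms(4) by (rule LeastI)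
  have least: "m \<le> j" if "(u, v) \<in> R ^^ j" for j
    unfolding m_def using that by (rule Least_le)
  obtain f where f: "f 0 = u" "f m = v" "\<And>i. i < m \<Longrightarrow> (f i, f (Suc i)) \<in> R"
    using m unfolding relpow_fun_conv by blast
  have seg: "(f i, f (i + d)) \<in> R ^^ d" if "i + d \<le> m" for i d
    unfolding relpow_fun_conv
    by (rule exI[of _ "\<lambda>j. f (i + j)"]) (use that f(3) in auto)
  have "f i \<noteq> f j" if "i < j" "j \<le> m" for i j
  proof
    assume eq: "f i = f j"
    have "(f 0, f i) \<in> R ^^ i" "(f j, f m) \<in> R ^^ (m - j)"
      using seg[of 0 i] seg[of j "m - j"] that by auto
    then have "(u, v) \<in> R ^^ (i + (m - j))"
      using relpow_trans[of "f 0" "f i" i R "f m" "m - j"] f(1,2) eq by simp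
    from least[OF this] show False using that by linarith
  qed
  then have "inj_on f {0..m}"
    by (metis atLeastAtMost_iff inj_onI linorder_neqE_nat)
  moreover have "f ` {0..m} \<subseteq> W"
  proof
    fix y assume "y \<in> f ` {0..m}"
    then obtain i where "i \<le> m" "y = f i" by auto
    then show "y \<in> W" using f assms(2,3) by (cases i) (auto simp: Suc_le_eq)
  qed
  ultimately have "Suc m \<le> card W"
    using card_inj_on_le[of f "{0..m}" W] assms(1) by simp
  then have "m < card W" by simp
  with m show ?thesis by blast
qed

text \<open>The bipartite double cover turns parity constraints on walk lengths into reachability.\<close>

definition double_cover :: "'a rel \<Rightarrow> ('a \<times> bool) rel" where
  "double_cover R = {((u, b), (v, \<not> b)) | u v b. (u, v) \<in> R}"

lemma relpow_double_cover:
  "((u, b), (v, c)) \<in> double_cover R ^^ k \<longleftrightarrow> (u, v) \<in> R ^^ k \<and> (c = b \<longleftrightarrow> even k)"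
proof (induction k arbitrary: v c)
  case (Suc k)
  have "((u, b), (v, c)) \<in> double_cover R ^^ Suc k \<longleftrightarrow>
     (\<exists>w. ((u, b), (w, \<not> c)) \<in> double_cover R ^^ k \<and> (w, v) \<in> R)"
    by (auto simp: double_cover_def relcomp_unfold)
  also have "\<dots> \<longleftrightarrow> (\<exists>w. (u, w) \<in> R ^^ k \<and> (w, v) \<in> R) \<and> (c = b \<longleftrightarrow> even (Suc k))"
    using Suc by auto
  finally show ?case by (simp only: relpow.simps relcomp_unfold) simp
qed auto

text \<open>A shortest walk in the double cover has the right parity and fewer than
  \<open>2 * card V\<close> steps; the even remainder is spent going back and forth along an edge at
  \<open>v\<close>, which exists because \<open>0 < k\<close>.\<close>

lemma relpow_same_parity:
  assumes "finite V" "R \<subseteq> V \<times> V" "sym R" "(u, v) \<in> R ^^ k" "0 < k"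
    and "2 * card V \<le> k'" "even k \<longleftrightarrow> even k'"
  shows "(u, v) \<in> R ^^ k'"
proof -
  obtain w where "(w, v) \<in> R"
    using assms(4,5) by (cases k) auto
  then have loops: "(v, v) \<in> R ^^ (2 * j)" for j
  proof (induction j)
    case (Suc j)
    have "(v, v) \<in> R ^^ 2"
      using Suc.prems assms(3) by (auto simp: numeral_2_eq_2 dest: symD)
    with Suc show ?case using relpow_trans[of v v 2 R v "2 * j"] by simp
  qed simp
  have u: "u \<in> V"
    using assms(2,4,5) relpow_Suc_D2[where R = R and n = "k - 1" and x = u and z = v] by auto
  have "((u, True), (v, even k)) \<in> double_cover R ^^ k"
    using assms(4) by (simp add: relpow_double_cover)
  moreover have "double_cover R \<subseteq> (V \<times> UNIV) \<times> (V \<times> UNIV)"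
    using assms(2) by (auto simp: double_cover_def)
  ultimately obtain j where j: "j < card (V \<times> (UNIV :: bool set))"
      "((u, True), (v, even k)) \<in> double_cover R ^^ j"
    using relpow_short[of "V \<times> UNIV" "double_cover R" "(u, True)" "(v, even k)" k] assms(1) u
    by (auto simp: finite_cartesian_product)
  have "(u, v) \<in> R ^^ j" "even j \<longleftrightarrow> even k'" "j \<le> k'"
    using j assms(6,7) by (auto simp: relpow_double_cover card_cartesian_product)
  moreover from this have "even (k' - j)" by simp
  then obtain d where "k' - j = 2 * d" by (elim evenE)
  moreover from this \<open>j \<le> k'\<close> have "k' = j + 2 * d" by simp
  ultimately show ?thesis using relpow_trans[OF _ loops[of d]] by blast
qed

text \<open>For a connected graph this is membership in the same colour class if the graph is
  bipartite, and relates all colours otherwise; it lets both kinds of state space be treated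
  alike.\<close>

definition even_linked :: "'a rel \<Rightarrow> 'a rel" where
  "even_linked R = {(u, v). \<exists>k. even k \<and> (u, v) \<in> R ^^ k}"

lemma even_linked_refl: "(u, u) \<in> even_linked R"
  unfolding even_linked_def by (auto intro!: exI[of _ 0])

lemma even_linked_sym: "sym R \<Longrightarrow> (u, v) \<in> even_linked R \<Longrightarrow> (v, u) \<in> even_linked R"
proof -
  assume "sym R" "(u, v) \<in> even_linked R"
  then obtain k where "even k" "(v, u) \<in> R ^^ k"
    unfolding even_linked_def by (auto intro: relpow_symD)
  then show ?thesis unfolding even_linked_def by blast
qed

lemma even_linked_step:
  assumes "sym R" "(u, v) \<in> even_linked R" "(u, u') \<in> R ^^ k" "(v, v') \<in> R ^^ k"
  shows "(u', v') \<in> even_linked R"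
proof -
  obtain j where "even j" "(u, v) \<in> R ^^ j" using assms(2) by (auto simp: even_linked_def)
  moreover have "(u', u) \<in> R ^^ k" using assms(1,3) by (rule relpow_symD)
  ultimately have "(u', v') \<in> R ^^ (k + j + k)"
    using assms(4) by (blast intro: relpow_trans)
  moreover have "even (k + j + k)" using \<open>even j\<close> by simp
  ultimately show ?thesis unfolding even_linked_def by blast
qed

text \<open>Replacing a boundary colour by an even-linked one leaves the set of colours possible at
  distance \<open>k\<close> unchanged.\<close>

lemma even_linked_walk:
  assumes "finite V" "R \<subseteq> V \<times> V" "sym R"
    and "(u, v) \<in> even_linked R" "(v, w) \<in> R ^^ k" "0 < k" "2 * card V \<le> k"
  shows "(u, w) \<in> R ^^ k"
proof -
  obtain j where "even j" "(u, v) \<in> R ^^ j" using assms(4) by (auto simp: even_linked_def)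
  have "(u, w) \<in> R ^^ (j + k)" using \<open>(u, v) \<in> R ^^ j\<close> assms(5) by (rule relpow_trans)
  then show ?thesis
    using relpow_same_parity[OF assms(1-3), of u w "j + k" k] assms(6,7) \<open>even j\<close> by simp
qed

section \<open>Couplings\<close>

definition couplings :: "'a pmf \<Rightarrow> 'b pmf \<Rightarrow> ('a \<times> 'b) pmf set" where
  "couplings p q = {\<kappa>. map_pmf fst \<kappa> = p \<and> map_pmf snd \<kappa> = q}"

lemma pair_pmf_couplings: "pair_pmf p q \<in> couplings p q"
  by (simp add: couplings_def map_fst_pair_pmf map_snd_pair_pmf)

lemma couplings_refl: "map_pmf (\<lambda>x. (x, x)) p \<in> couplings p p"
  by (simp add: couplings_def pmf.map_comp o_def)

lemma couplings_support:
  assumes "\<kappa> \<in> couplings p q" "z \<in> set_pmf \<kappa>"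
  shows "fst z \<in> set_pmf p" "snd z \<in> set_pmf q"
  using assms by (auto simp: couplings_def)

lemma measure_pmf_bind_le:
  assumes "\<And>z. z \<in> set_pmf \<kappa> \<Longrightarrow> measure_pmf.prob (K z) A \<le> g z"
    and "integrable (measure_pmf \<kappa>) g"
  shows "measure_pmf.prob (bind_pmf \<kappa> K) A \<le> measure_pmf.expectation \<kappa> g"
proof -
  have "measure_pmf.prob (bind_pmf \<kappa> K) A = measure_pmf.expectation \<kappa> (\<lambda>z. measure_pmf.prob (K z) A)"
    by (subst measure_pmf_bind, subst measure_pmf.measure_bind[where N = "count_space UNIV"])
      (auto simp: measurable_def space_subprob_algebra
        intro!: prob_space_imp_subprob_space measure_pmf.prob_space_axioms)
  also have "\<dots> \<le> measure_pmf.expectation \<kappa> g"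
    by (rule integral_mono_AE)
      (use assms in \<open>auto simp: AE_measure_pmf_iff intro!: measure_pmf.integrable_const_bound[where B = 1]\<close>)
  finally show ?thesis .
qed

lemma bind_couplings:
  assumes "\<kappa> \<in> couplings p q"
    and "\<And>x y. (x, y) \<in> set_pmf \<kappa> \<Longrightarrow> K (x, y) \<in> couplings (k x) (l y)"
  shows "bind_pmf \<kappa> K \<in> couplings (bind_pmf p k) (bind_pmf q l)"
proof -
  have "map_pmf fst (bind_pmf \<kappa> K) = bind_pmf \<kappa> (\<lambda>z. k (fst z))"
    unfolding map_bind_pmf by (rule bind_pmf_cong) (use assms(2) in \<open>auto simp: couplings_def\<close>)
  moreover have "map_pmf snd (bind_pmf \<kappa> K) = bind_pmf \<kappa> (\<lambda>z. l (snd z))"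
    unfolding map_bind_pmf by (rule bind_pmf_cong) (use assms(2) in \<open>auto simp: couplings_def\<close>)
  moreover have "bind_pmf p k = bind_pmf \<kappa> (\<lambda>z. k (fst z))" "bind_pmf q l = bind_pmf \<kappa> (\<lambda>z. l (snd z))"
    using assms(1) by (auto simp: couplings_def bind_map_pmf)
  ultimately show ?thesis by (simp add: couplings_def)
qed

text \<open>The common marginal \<open>q\<close> allows both couplings to live on one space, where
  the middle component is dropped. The union bound quantifies over all relations because a single
  \<open>\<kappa>\<close> has to serve every site.\<close>

lemma glue_couplings:
  fixes p :: "'a pmf" and q :: "'b pmf" and r :: "'c pmf"
  assumes "\<kappa>1 \<in> couplings p q" "\<kappa>2 \<in> couplings q r"
  obtains \<kappa> where "\<kappa> \<in> couplings p r"
    and "\<And>(R :: 'a \<Rightarrow> 'c \<Rightarrow> bool) (P :: 'a \<Rightarrow> 'b \<Rightarrow> bool) (Q :: 'b \<Rightarrow> 'c \<Rightarrow> bool). (\<And>x y z. R x z \<Longrightarrow> P x y \<or> Q y z) \<Longrightarrow>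
      measure_pmf.prob \<kappa> {(x, z). R x z} \<le>
        measure_pmf.prob \<kappa>1 {(x, y). P x y} + measure_pmf.prob \<kappa>2 {(y, z). Q y z}"
proof -
  have "rel_pmf (=) (map_pmf snd \<kappa>1) (map_pmf fst \<kappa>2)"
    using assms by (simp add: couplings_def pmf.rel_eq)
  then have "rel_pmf (\<lambda>a b. snd a = fst b) \<kappa>1 \<kappa>2"
    by (simp add: pmf.rel_map)
  then obtain \<tau> where \<tau>: "\<And>a b. (a, b) \<in> set_pmf \<tau> \<Longrightarrow> snd a = fst b"
      "map_pmf fst \<tau> = \<kappa>1" "map_pmf snd \<tau> = \<kappa>2"
    by (auto elim!: rel_pmf.cases)
  define \<kappa> where "\<kappa> = map_pmf (\<lambda>(a, b). (fst a, snd b)) \<tau>"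
  show thesis
  proof (rule that[of \<kappa>])
    have "map_pmf fst \<kappa> = map_pmf fst \<kappa>1" "map_pmf snd \<kappa> = map_pmf snd \<kappa>2"
      unfolding \<kappa>_def \<tau>(2,3)[symmetric] by (simp_all add: pmf.map_comp o_def case_prod_beta)
    then show "\<kappa> \<in> couplings p r" using assms by (simp add: couplings_def)
    fix R :: "'a \<Rightarrow> 'c \<Rightarrow> bool" and P :: "'a \<Rightarrow> 'b \<Rightarrow> bool" and Q :: "'b \<Rightarrow> 'c \<Rightarrow> bool"
    assume RPQ: "\<And>x y z. R x z \<Longrightarrow> P x y \<or> Q y z"
    let ?A = "{t. P (fst (fst t)) (snd (fst t))}" and ?B = "{t. Q (fst (snd t)) (snd (snd t))}"
    have "measure_pmf.prob \<kappa> {(x, z). R x z} = measure_pmf.prob \<tau> {t. R (fst (fst t)) (snd (snd t))}"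
      unfolding \<kappa>_def by (simp add: measure_map_pmf vimage_def case_prod_unfold)
    also have "\<dots> \<le> measure_pmf.prob \<tau> (?A \<union> ?B)"
    proof (rule measure_pmf.finite_measure_mono_AE)
      show "AE t in measure_pmf \<tau>. t \<in> {t. R (fst (fst t)) (snd (snd t))} \<longrightarrow> t \<in> ?A \<union> ?B"
        using \<tau>(1) RPQ by (fastforce simp: AE_measure_pmf_iff)
    qed auto
    also have "\<dots> \<le> measure_pmf.prob \<tau> ?A + measure_pmf.prob \<tau> ?B"
      by (rule measure_Un_le) auto
    also have "measure_pmf.prob \<tau> ?A = measure_pmf.prob \<kappa>1 {(x, y). P x y}"
      unfolding \<tau>(2)[symmetric] by (simp add: measure_map_pmf vimage_def case_prod_unfold)
    also have "measure_pmf.prob \<tau> ?B = measure_pmf.prob \<kappa>2 {(y, z). Q y z}"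
      unfolding \<tau>(3)[symmetric] by (simp add: measure_map_pmf vimage_def case_prod_unfold)
    finally show "measure_pmf.prob \<kappa> {(x, z). R x z} \<le>
        measure_pmf.prob \<kappa>1 {(x, y). P x y} + measure_pmf.prob \<kappa>2 {(y, z). Q y z}" .
  qed
qed

text \<open>Gluing twice: \<open>\<sigma>\<close> joins \<open>p\<close> to \<open>\<kappa>\<close>
  along \<open>f\<close>, then \<open>\<tau>\<close> joins \<open>\<sigma>\<close> to
  \<open>q\<close> along \<open>g\<close>.\<close>

lemma lift_couplings:
  assumes "\<kappa> \<in> couplings (map_pmf f p) (map_pmf g q)"
  obtains \<kappa>' where "\<kappa>' \<in> couplings p q" "map_pmf (map_prod f g) \<kappa>' = \<kappa>"
proof -
  have "rel_pmf (=) (map_pmf f p) (map_pmf fst \<kappa>)"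
    using assms by (simp add: couplings_def pmf.rel_eq)
  then have "rel_pmf (\<lambda>a b. f a = fst b) p \<kappa>"
    by (simp add: pmf.rel_map)
  then obtain \<sigma> where \<sigma>: "\<And>a b. (a, b) \<in> set_pmf \<sigma> \<Longrightarrow> f a = fst b"
      "map_pmf fst \<sigma> = p" "map_pmf snd \<sigma> = \<kappa>"
    by (auto elim!: rel_pmf.cases)
  have "map_pmf (\<lambda>t. snd (snd t)) \<sigma> = map_pmf snd (map_pmf snd \<sigma>)"
    by (simp add: pmf.map_comp o_def)
  then have "rel_pmf (=) (map_pmf (\<lambda>t. snd (snd t)) \<sigma>) (map_pmf g q)"
    using assms by (simp add: couplings_def pmf.rel_eq \<sigma>(3))
  then have "rel_pmf (\<lambda>t b. snd (snd t) = g b) \<sigma> q"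
    by (simp add: pmf.rel_map)
  then obtain \<tau> where \<tau>: "\<And>t b. (t, b) \<in> set_pmf \<tau> \<Longrightarrow> snd (snd t) = g b"
      "map_pmf fst \<tau> = \<sigma>" "map_pmf snd \<tau> = q"
    by (auto elim!: rel_pmf.cases)
  define \<kappa>' where "\<kappa>' = map_pmf (\<lambda>t. (fst (fst t), snd t)) \<tau>"
  have supp: "fst t \<in> set_pmf \<sigma>" if "t \<in> set_pmf \<tau>" for t
    using that unfolding \<tau>(2)[symmetric] by simp
  show thesis
  proof (rule that[of \<kappa>'])
    have "map_pmf fst \<kappa>' = map_pmf fst \<sigma>"
      unfolding \<kappa>'_def \<tau>(2)[symmetric] by (simp add: pmf.map_comp o_def)
    moreover have "map_pmf snd \<kappa>' = q"
      unfolding \<kappa>'_def \<tau>(3)[symmetric] by (simp add: pmf.map_comp o_def)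
    ultimately show "\<kappa>' \<in> couplings p q" by (simp add: couplings_def \<sigma>(2))
    have "map_pmf (map_prod f g) \<kappa>' = map_pmf (\<lambda>t. snd (fst t)) \<tau>"
      unfolding \<kappa>'_def pmf.map_comp
    proof (rule map_pmf_cong[OF refl])
      fix t assume t: "t \<in> set_pmf \<tau>"
      have "f (fst (fst t)) = fst (snd (fst t))" using \<sigma>(1)[of "fst (fst t)" "snd (fst t)"] supp[OF t] by simp
      moreover have "snd (snd (fst t)) = g (snd t)" using \<tau>(1)[of "fst t" "snd t"] t by simp
      ultimately show "(map_prod f g \<circ> (\<lambda>t. (fst (fst t), snd t))) t = snd (fst t)"
        by (simp add: prod_eq_iff)
    qed
    also have "\<dots> = \<kappa>"
      unfolding \<sigma>(3)[symmetric] \<tau>(2)[symmetric] by (simp add: pmf.map_comp o_def)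
    finally show "map_pmf (map_prod f g) \<kappa>' = \<kappa>" .
  qed
qed

text \<open>The residual law is (p - \<epsilon> \<nu>) / (1 - \<epsilon>), nonnegative and of mass
  1.\<close>

lemma minorised_pmf_mixture:
  assumes "0 < \<epsilon>" "\<epsilon> < 1" "\<And>b. \<epsilon> * pmf \<nu> b \<le> pmf p b"
  obtains p' where "p = bind_pmf (bernoulli_pmf \<epsilon>) (\<lambda>c. if c then \<nu> else p')"
proof -
  define f where "f b = (pmf p b - \<epsilon> * pmf \<nu> b) / (1 - \<epsilon>)" for b
  have nonneg: "0 \<le> f b" for b using assms unfolding f_def by simp
  have int: "integrable (count_space UNIV) f"
    unfolding f_def by (auto intro!: Bochner_Integration.integrable_diff integrable_pmf)
  have "(\<integral>b. f b \<partial>count_space UNIV) = 1"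
    unfolding f_def using assms(2)
    by (simp add: Bochner_Integration.integral_diff integrable_pmf integral_pmf)
  then have one: "(\<integral>\<^sup>+b. ennreal (f b) \<partial>count_space UNIV) = 1"
    using nn_integral_eq_integral[OF int] nonneg by simp
  have "p = bind_pmf (bernoulli_pmf \<epsilon>) (\<lambda>c. if c then \<nu> else embed_pmf f)"
    using assms(1,2) by (intro pmf_eqI)
      (simp add: pmf_bind pmf_embed_pmf[OF nonneg one], simp add: f_def field_simps)
  then show thesis by (rule that)
qed

text \<open>Both copies toss the same \<epsilon>-coin: on success they take one common sample of
  \<open>\<nu>\<close>, on failure they draw from their residual laws independently.\<close>

lemma minorised_coupling:
  assumes "0 < \<epsilon>" "\<epsilon> \<le> 1"
    and "\<And>b. \<epsilon> * pmf \<nu> b \<le> pmf p b" "\<And>b. \<epsilon> * pmf \<nu> b \<le> pmf q b"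
  obtains \<kappa> where "\<kappa> \<in> couplings p q" "measure_pmf.prob \<kappa> {(x, y). x \<noteq> y} \<le> 1 - \<epsilon>"
proof (cases "\<epsilon> = 1")
  case True
  \<comment> \<open>Here no residual law exists. The case does arise, from fibres of size one in
    \<open>same_boundary_coupling\<close>. Pointwise domination of one probability law by another
    forces equality, by comparing complements of points.\<close>
  have dom: "p = \<nu>" if "\<And>b. pmf \<nu> b \<le> pmf p b" for p
  proof (rule pmf_eqI, rule antisym[OF _ that])
    fix b
    have "measure_pmf.prob \<nu> (UNIV - {b}) \<le> measure_pmf.prob p (UNIV - {b})"
      unfolding measure_pmf_conv_infsetsum
      by (rule infsetsum_mono) (auto simp: that pmf_abs_summable)
    then show "pmf p b \<le> pmf \<nu> b"
      using measure_pmf.prob_compl[of "{b}" \<nu>] measure_pmf.prob_compl[of "{b}" p]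
      by (simp add: measure_pmf_single)
  qed
  have "p = q" using dom[of p] dom[of q] assms(3,4) True by simp
  then show thesis
    using that[of "map_pmf (\<lambda>x. (x, x)) p"] couplings_refl[of p] True
    by (simp add: measure_map_pmf vimage_def)
next
  case False
  then have \<epsilon>: "0 < \<epsilon>" "\<epsilon> < 1" using assms by auto
  obtain p' where p': "p = bind_pmf (bernoulli_pmf \<epsilon>) (\<lambda>c. if c then \<nu> else p')"
    using minorised_pmf_mixture[OF \<epsilon> assms(3)] by blast
  obtain q' where q': "q = bind_pmf (bernoulli_pmf \<epsilon>) (\<lambda>c. if c then \<nu> else q')"
    using minorised_pmf_mixture[OF \<epsilon> assms(4)] by blast
  let ?K = "\<lambda>c. if c then map_pmf (\<lambda>x. (x, x)) \<nu> else pair_pmf p' q'"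
  let ?\<kappa> = "bind_pmf (bernoulli_pmf \<epsilon>) ?K"
  have "measure_pmf.prob ?\<kappa> {(x, y). x \<noteq> y}
      \<le> measure_pmf.expectation (bernoulli_pmf \<epsilon>) (\<lambda>c. if c then 0 else 1)"
    by (rule measure_pmf_bind_le)
      (auto simp: measure_map_pmf vimage_def intro!: measure_pmf.integrable_const_bound[where B = 1])
  also have "\<dots> = 1 - \<epsilon>" using \<epsilon> by simp
  finally have "measure_pmf.prob ?\<kappa> {(x, y). x \<noteq> y} \<le> 1 - \<epsilon>" .
  moreover have "?\<kappa> \<in> couplings p q"
    unfolding couplings_def p' q'
    by (auto simp: map_bind_pmf pmf.map_comp o_def map_fst_pair_pmf map_snd_pair_pmf intro!: bind_pmf_cong)
  ultimately show thesis by (rule that[rotated])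
qed

text \<open>At each state the mass of the diagonal cancels, so the difference is bounded by the
  off-diagonal mass with that state as first or as second component. Summation counts the
  off-diagonal twice, which the factor 1/2 absorbs.\<close>

lemma tv_dist_le_coupling:
  assumes "finite S" "\<kappa> \<in> couplings p q"
  shows "tv_dist S p q \<le> measure_pmf.prob \<kappa> {(x, y). x \<noteq> y}"
proof -
  let ?D = "{(x, y). x \<noteq> y}"
  have pq: "p = map_pmf fst \<kappa>" "q = map_pmf snd \<kappa>" using assms(2) by (auto simp: couplings_def)
  let ?P = "\<lambda>A. measure_pmf.prob \<kappa> A"
  have sum_le: "(\<Sum>i\<in>S. ?P (?D \<inter> h -` {i})) \<le> ?P ?D" for h :: "'a \<times> 'a \<Rightarrow> 'a"
  proof -
    have "(\<Sum>i\<in>S. ?P (?D \<inter> h -` {i})) = ?P (\<Union>i\<in>S. ?D \<inter> h -` {i})"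
      by (rule measure_pmf.finite_measure_finite_Union[symmetric])
        (use assms(1) in \<open>auto simp: disjoint_family_on_def\<close>)
    also have "\<dots> \<le> ?P ?D" by (rule measure_pmf.finite_measure_mono) auto
    finally show ?thesis .
  qed
  have "\<bar>pmf p i - pmf q i\<bar> \<le> ?P (?D \<inter> fst -` {i}) + ?P (?D \<inter> snd -` {i})" for i
  proof -
    let ?E = "{z. fst z = i \<and> snd z = i}"
    have "pmf p i = ?P ((?D \<inter> fst -` {i}) \<union> ?E)" "pmf q i = ?P ((?D \<inter> snd -` {i}) \<union> ?E)"
      unfolding pq pmf_map by (auto intro!: arg_cong[where f = ?P])
    moreover have "?P ((?D \<inter> fst -` {i}) \<union> ?E) = ?P (?D \<inter> fst -` {i}) + ?P ?E"
      "?P ((?D \<inter> snd -` {i}) \<union> ?E) = ?P (?D \<inter> snd -` {i}) + ?P ?E"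
      by (auto intro!: measure_pmf.finite_measure_Union)
    moreover have "0 \<le> ?P (?D \<inter> fst -` {i})" "0 \<le> ?P (?D \<inter> snd -` {i})" by auto
    ultimately show ?thesis by linarith
  qed
  then have "(\<Sum>i\<in>S. \<bar>pmf p i - pmf q i\<bar>) \<le> (\<Sum>i\<in>S. ?P (?D \<inter> fst -` {i}) + ?P (?D \<inter> snd -` {i}))"
    by (rule sum_mono)
  also have "\<dots> \<le> ?P ?D + ?P ?D"
    unfolding sum.distrib by (intro add_mono sum_le)
  finally show ?thesis unfolding tv_dist_def by simp
qed

text \<open>The sets \<open>B x\<close> partition \<open>A\<close>, and redrawing within the class
  of a uniform element keeps it uniform. This yields both stationarity of the moves and
  \<open>resample\<close>.\<close>

lemma bind_pmf_of_set_partition: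
  assumes "finite A" "A \<noteq> {}"
    and "\<And>x. x \<in> A \<Longrightarrow> x \<in> B x \<and> B x \<subseteq> A"
    and "\<And>x y. x \<in> A \<Longrightarrow> y \<in> B x \<Longrightarrow> B y = B x"
  shows "bind_pmf (pmf_of_set A) (\<lambda>x. pmf_of_set (B x)) = pmf_of_set A"
proof (rule pmf_eqI)
  fix z
  have fin: "finite (B x)" if "x \<in> A" for x using that assms(1,3) finite_subset by blast
  have *: "pmf (pmf_of_set (B x)) z = (if x \<in> B z \<and> z \<in> A then 1 / card (B z) else 0)"
    if "x \<in> A" for x
  proof -
    have ne: "B x \<noteq> {}" using that assms(3) by blast
    have "z \<in> B x \<longleftrightarrow> x \<in> B z \<and> z \<in> A" using that assms(3,4) by blast
    moreover have "B x = B z" if "z \<in> B x" using \<open>x \<in> A\<close> that assms(4) by blast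
    ultimately show ?thesis by (simp add: pmf_of_set[OF ne fin[OF that]] indicator_def)
  qed
  have "pmf (bind_pmf (pmf_of_set A) (\<lambda>x. pmf_of_set (B x))) z
      = (\<Sum>x\<in>A. pmf (pmf_of_set (B x)) z) / card A"
    using assms(1,2) by (simp add: pmf_bind integral_pmf_of_set)
  also have "\<dots> = (\<Sum>x\<in>A. if x \<in> B z \<and> z \<in> A then 1 / card (B z) else 0) / card A"
    using * by simp
  also have "\<dots> = indicator A z / card A"
  proof (cases "z \<in> A")
    case True
    then have "(\<Sum>x\<in>A. if x \<in> B z \<and> z \<in> A then 1 / card (B z) else 0) = (\<Sum>x\<in>B z. 1 / card (B z))"
      using assms(1,3) by (intro sum.mono_neutral_cong_right) auto
    also have "\<dots> = 1" using True assms(3) fin[of z] by auto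
    finally show ?thesis using True by simp
  qed simp
  finally show "pmf (bind_pmf (pmf_of_set A) (\<lambda>x. pmf_of_set (B x))) z = pmf (pmf_of_set A) z"
    using assms(1,2) by simp
qed

text \<open>
  Both push-forwards under \<open>g\<close> dominate \<open>1 / M\<close> times the uniform law on the common image.
\<close>

lemma uniform_fibre_coupling:
  fixes g :: "'a \<Rightarrow> 'b"
  assumes "finite A" "A \<noteq> {}" "finite A'" "g ` A = g ` A'" "0 < M"
    and "\<And>b. card {x \<in> A. g x = b} \<le> M" "\<And>b. card {x \<in> A'. g x = b} \<le> M"
  obtains \<kappa> where "\<kappa> \<in> couplings (pmf_of_set A) (pmf_of_set A')"
    "measure_pmf.prob \<kappa> {(x, y). g x \<noteq> g y} \<le> 1 - 1 / real M"
proof -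
  define B where "B = g ` A"
  have B: "finite B" "B \<noteq> {}" using assms by (auto simp: B_def)
  have minor: "1 / real M * pmf (pmf_of_set B) b \<le> pmf (map_pmf g (pmf_of_set X)) b"
    if X: "finite X" "X \<noteq> {}" "g ` X = B" "\<And>b. card {x \<in> X. g x = b} \<le> M" for X b
  proof (cases "b \<in> B")
    case True
    \<comment> \<open>At most \<open>card B\<close> fibres of size at most \<open>M\<close> cover
      \<open>X\<close>, so a single point of the fibre over \<open>b\<close> already weighs 1 / card
      X \<ge> 1 / (M card B).\<close>
    have "X = (\<Union>b\<in>B. {x \<in> X. g x = b})" using X(3) by auto
    then have "card X \<le> (\<Sum>b\<in>B. card {x \<in> X. g x = b})"
      using card_UN_le[OF B(1), of "\<lambda>b. {x \<in> X. g x = b}"] by argo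
    also have "\<dots> \<le> card B * M" using sum_mono[of B _ "\<lambda>_. M"] X(4) by simp
    finally have "real (card X) \<le> card B * M" by (metis of_nat_le_iff of_nat_mult)
    moreover have "1 \<le> card (X \<inter> g -` {b})"
      using True X(1,3) by (auto simp: Suc_le_eq card_gt_0_iff)
    moreover have "0 < card X" "0 < card B" using X B by (auto simp: card_gt_0_iff)
    ultimately have "1 / (real M * real (card B)) \<le> real (card (X \<inter> g -` {b})) / real (card X)"
      by (intro frac_le) (simp_all add: mult.commute)
    then show ?thesis
      using True B X(1,2) by (simp add: pmf_map measure_pmf_of_set)
  qed (use B in simp)
  have A': "A' \<noteq> {}" using assms by auto
  obtain \<kappa> where \<kappa>: "\<kappa> \<in> couplings (map_pmf g (pmf_of_set A)) (map_pmf g (pmf_of_set A'))"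
      "measure_pmf.prob \<kappa> {(x, y). x \<noteq> y} \<le> 1 - 1 / real M"
    using minorised_coupling[of "1 / real M" "pmf_of_set B" "map_pmf g (pmf_of_set A)" "map_pmf g (pmf_of_set A')"]
      minor[of A] minor[of A'] assms A' by (auto simp: B_def)
  obtain \<kappa>' where \<kappa>': "\<kappa>' \<in> couplings (pmf_of_set A) (pmf_of_set A')" "map_pmf (map_prod g g) \<kappa>' = \<kappa>"
    using lift_couplings[OF \<kappa>(1)] by blast
  have "measure_pmf.prob \<kappa>' {(x, y). g x \<noteq> g y} = measure_pmf.prob \<kappa> {(x, y). x \<noteq> y}"
    unfolding \<kappa>'(2)[symmetric] by (simp add: measure_map_pmf vimage_def case_prod_unfold)
  then show thesis using that \<kappa>'(1) \<kappa>(2) by simp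
qed

section \<open>Heat-bath moves on intervals\<close>

text \<open>The state space is kept out of this locale because the intermediate configurations of
  the coupling belong to \<open>conf\<close> but possibly to no state space.\<close>

locale colour_path =
  fixes H :: "'c pair_pre_digraph" and n s :: nat
  assumes pseudo: "pair_pseudo_graph H"
    and conn: "Digraph_Component.connected (with_proj H)"
    and s_ge: "2 * card (pverts H) \<le> s"
begin

abbreviation "R \<equiv> parcs H"
abbreviation "V \<equiv> pverts H"
abbreviation "q \<equiv> card V"
abbreviation "hb \<equiv> heat_bath_set H n"
abbreviation "U \<Lambda> x \<equiv> pmf_of_set (hb \<Lambda> x)"
abbreviation "conf \<equiv> configurations H n"

lemma finite_V: "finite V"
  using pseudo by (simp add: pair_pseudo_graph_def pair_fin_digraph_def pair_fin_digraph_axioms_def)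

lemma R_subset: "R \<subseteq> V \<times> V"
proof -
  interpret pair_pseudo_graph H by (rule pseudo)
  show ?thesis using in_arcsD1 in_arcsD2 by auto
qed

lemma sym_R: "sym R"
  using pseudo unfolding pair_pseudo_graph_def pair_sym_digraph_def pair_sym_digraph_axioms_def
  by (auto simp: symmetric_def)

lemma V_nonempty: "V \<noteq> {}"
  using conn by (simp add: connected_conv)

lemma q_pos: "0 < q"
  using finite_V V_nonempty by (simp add: card_gt_0_iff)

lemma s_ge_2: "2 \<le> s"
  using s_ge q_pos by linarith

lemma s_pos: "0 < s"
  using s_ge_2 by linarith

lemma reach: assumes "u \<in> V" "v \<in> V" shows "\<exists>k. (u, v) \<in> R ^^ k"
proof -
  have "(u, v) \<in> rtrancl_on V (R\<^sup>s)" using conn assms by (simp add: connected_conv)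
  then have "(u, v) \<in> (R\<^sup>s)\<^sup>*" by (rule rtrancl_on_rtranclI)
  moreover have "R\<^sup>s = R" using sym_R by (auto simp: symcl_def sym_conv_converse_eq)
  ultimately show ?thesis by (simp add: rtrancl_is_UN_relpow)
qed

lemma finite_conf: "finite conf"
  unfolding configurations_def by (auto intro!: finite_PiE finite_V)

lemma hb_conf: "y \<in> hb \<Lambda> x \<Longrightarrow> y \<in> conf"
  by (simp add: heat_bath_set_def)

lemma conf_V: "x \<in> conf \<Longrightarrow> 1 \<le> i \<Longrightarrow> i \<le> n \<Longrightarrow> x i \<in> V"
  by (auto simp: configurations_def)

lemma conf_outside: "x \<in> conf \<Longrightarrow> i \<notin> {1..n} \<Longrightarrow> x i = undefined"
  by (auto simp: configurations_def)

lemma confI: "(\<And>i. 1 \<le> i \<Longrightarrow> i \<le> n \<Longrightarrow> x i \<in> V) \<Longrightarrow> (\<And>i. i \<notin> {1..n} \<Longrightarrow> x i = undefined) \<Longrightarrow> x \<in> conf"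
  unfolding configurations_def by (auto intro!: PiE_I)

lemma hb_outside: "y \<in> hb \<Lambda> x \<Longrightarrow> x \<in> conf \<Longrightarrow> i \<notin> \<Lambda> \<Longrightarrow> y i = x i"
  using conf_outside[of y i] conf_outside[of x i]
  by (cases "i \<in> {1..n}") (auto simp: heat_bath_set_def)

lemma hb_edge:
  "y \<in> hb \<Lambda> x \<Longrightarrow> 1 \<le> i \<Longrightarrow> i < n \<Longrightarrow> i \<in> \<Lambda> \<or> i + 1 \<in> \<Lambda> \<Longrightarrow> (y i, y (i + 1)) \<in> R"
  by (simp add: heat_bath_set_def)

lemma finite_hb: "finite (hb \<Lambda> x)"
  by (rule finite_subset[OF _ finite_conf]) (auto simp: hb_conf)

lemma hb_self: "x \<in> colourings H n \<Longrightarrow> x \<in> hb \<Lambda> x"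
  by (auto simp: heat_bath_set_def colourings_def)

lemma hb_cong: "(\<And>i. i \<in> {1..n} - \<Lambda> \<Longrightarrow> x i = y i) \<Longrightarrow> hb \<Lambda> x = hb \<Lambda> y"
  unfolding heat_bath_set_def by auto

lemma hb_class: "y \<in> hb \<Lambda> x \<Longrightarrow> hb \<Lambda> y = hb \<Lambda> x"
  by (rule hb_cong) (auto simp: heat_bath_set_def)

text \<open>An edge that meets \<open>\<Lambda>\<close> but not \<open>\<Lambda>'\<close> keeps the
  colours it has in \<open>y\<close>. With \<open>hb_class\<close> this says that the sets
  \<open>hb \<Lambda>' y\<close> partition \<open>hb \<Lambda> x\<close>.\<close>

lemma hb_refine:
  assumes "\<Lambda>' \<subseteq> \<Lambda>" "y \<in> hb \<Lambda> x"
  shows "y \<in> hb \<Lambda>' y \<and> hb \<Lambda>' y \<subseteq> hb \<Lambda> x"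
proof (intro conjI subsetI)
  show "y \<in> hb \<Lambda>' y" using assms by (auto simp: heat_bath_set_def)
  fix z assume z: "z \<in> hb \<Lambda>' y"
  have "(z i, z (i + 1)) \<in> R" if "1 \<le> i" "i < n" "i \<in> \<Lambda> \<or> i + 1 \<in> \<Lambda>" for i
  proof (cases "i \<in> \<Lambda>' \<or> i + 1 \<in> \<Lambda>'")
    case True
    with that(1,2) show ?thesis using hb_edge[OF z] by blast
  next
    case False
    have y: "y \<in> conf" using assms(2) by (rule hb_conf)
    have "z i = y i" "z (i + 1) = y (i + 1)" using False hb_outside[OF z y] by auto
    then show ?thesis using hb_edge[OF assms(2) that] by simp
  qed
  moreover have "\<forall>i\<in>{1..n} - \<Lambda>. z i = x i"
  proof
    fix i assume i: "i \<in> {1..n} - \<Lambda>"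
    then have "z i = y i" using assms(1) z by (auto simp: heat_bath_set_def)
    also have "\<dots> = x i" using assms(2) i by (simp add: heat_bath_set_def)
    finally show "z i = x i" .
  qed
  ultimately show "z \<in> hb \<Lambda> x" using hb_conf[OF z] unfolding heat_bath_set_def by auto
qed

lemma resample:
  assumes "\<Lambda>' \<subseteq> \<Lambda>" "hb \<Lambda> x \<noteq> {}"
  shows "bind_pmf (U \<Lambda> x) (U \<Lambda>') = U \<Lambda> x"
  using assms finite_hb hb_refine[OF assms(1)] hb_class
  by (intro bind_pmf_of_set_partition) auto

section \<open>Walks along the path, and carrying block fillings from one boundary to
  another\<close>

lemma walk_along:
  assumes "a \<le> b" "\<And>i. a \<le> i \<Longrightarrow> i < b \<Longrightarrow> (y i, y (i + 1)) \<in> R"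
  shows "(y a, y b) \<in> R ^^ (b - a)"
  unfolding relpow_fun_conv by (rule exI[of _ "\<lambda>i. y (a + i)"]) (use assms in auto)

lemma patch_walk:
  assumes "f \<in> conf" "1 \<le> a" "a < b" "b \<le> n" "(f a, f b) \<in> R ^^ (b - a)"
  obtains g where "g \<in> conf" "\<And>i. i \<notin> {a<..<b} \<Longrightarrow> g i = f i"
    "\<And>i. a \<le> i \<Longrightarrow> i < b \<Longrightarrow> (g i, g (i + 1)) \<in> R"
proof -
  obtain w where w: "w 0 = f a" "w (b - a) = f b" "\<And>i. i < b - a \<Longrightarrow> (w i, w (Suc i)) \<in> R"
    using assms(5) unfolding relpow_fun_conv by blast
  define g where "g i = (if i \<in> {a<..<b} then w (i - a) else f i)" for i
  have g: "g i = w (i - a)" if "a \<le> i" "i \<le> b" for i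
    using that w(1,2) assms(3) unfolding g_def by (cases "i = a"; cases "i = b") auto
  have edge: "(g i, g (i + 1)) \<in> R" if "a \<le> i" "i < b" for i
    using w(3)[of "i - a"] that by (simp add: g Suc_diff_le)
  have "g i \<in> V" if "a < i" "i < b" for i
    using edge[of i] that R_subset by auto
  then have "g i \<in> V" if "1 \<le> i" "i \<le> n" for i
    using conf_V[OF assms(1) that] by (cases "i \<in> {a<..<b}") (auto simp: g_def)
  then have "g \<in> conf"
    using assms conf_outside[OF assms(1)] by (intro confI) (auto simp: g_def)
  then show thesis using edge by (intro that[of g]) (auto simp: g_def)
qed

lemma transfer_same:
  assumes "x \<in> conf" "y \<in> conf" "\<Lambda> \<subseteq> {1..n}" "z \<in> hb \<Lambda> x"
    and "\<And>i j. i \<in> \<Lambda> \<Longrightarrow> j \<in> {1..n} - \<Lambda> \<Longrightarrow> j = i + 1 \<or> i = j + 1 \<Longrightarrow> x j = y j"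
  shows "\<exists>z' \<in> hb \<Lambda> y. \<forall>i\<in>\<Lambda>. z' i = z i"
proof -
  define f where "f i = (if i \<in> \<Lambda> then z i else y i)" for i
  have z: "z \<in> conf" using assms(4) by (rule hb_conf)
  have fz: "f i = z i" if "i \<in> \<Lambda> \<or> (i \<in> {1..n} \<and> (i + 1 \<in> \<Lambda> \<or> (\<exists>j\<in>\<Lambda>. i = j + 1)))" for i
    using that hb_outside[OF assms(4,1)] assms(5) by (cases "i \<in> \<Lambda>") (auto simp: f_def)
  have "f \<in> conf"
    using conf_V[OF z] conf_V[OF assms(2)] conf_outside[OF z] conf_outside[OF assms(2)]
    by (intro confI) (auto simp: f_def)
  moreover have "(f i, f (i + 1)) \<in> R" if "1 \<le> i" "i < n" "i \<in> \<Lambda> \<or> i + 1 \<in> \<Lambda>" for i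
    using fz[of i] fz[of "i + 1"] hb_edge[OF assms(4) that] that by auto
  ultimately have "f \<in> hb \<Lambda> y" by (auto simp: heat_bath_set_def f_def)
  then show ?thesis by (auto simp: f_def intro!: bexI[of _ f])
qed

text \<open>The new filling keeps \<open>z\<close> on \<open>T\<close> and \<open>y\<close> outside
  \<open>\<Lambda>\<close>, and a walk bridges the open gap between \<open>a\<close> and
  \<open>b\<close>. Each end of the gap lies in \<open>T\<close> or outside
  \<open>\<Lambda>\<close>, whence the case distinctions in \<open>walk\<close>.\<close>

lemma transfer_walk:
  assumes "x \<in> conf" "y \<in> conf" "\<Lambda> \<subseteq> {1..n}" "z \<in> hb \<Lambda> x" "T \<subseteq> \<Lambda>"
    and bd: "\<And>i j. i \<in> T \<Longrightarrow> j \<in> {1..n} - \<Lambda> \<Longrightarrow> j = i + 1 \<or> i = j + 1 \<Longrightarrow> x j = y j"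
    and D: "\<Lambda> - T = {a<..<b}" "1 \<le> a" "a < b" "b \<le> n"
    and walk: "((if a \<in> T then z a else y a), (if b \<in> T then z b else y b)) \<in> R ^^ (b - a)"
  shows "\<exists>z' \<in> hb \<Lambda> y. \<forall>i\<in>T. z' i = z i"
proof -
  define f where "f i = (if i \<in> T then z i else y i)" for i
  have z: "z \<in> conf" using assms(4) by (rule hb_conf)
  have "f \<in> conf"
    using conf_V[OF z] conf_V[OF assms(2)] conf_outside[OF z] conf_outside[OF assms(2)]
    by (intro confI) (auto simp: f_def)
  then obtain g where g: "g \<in> conf" "\<And>i. i \<notin> {a<..<b} \<Longrightarrow> g i = f i"
    "\<And>i. a \<le> i \<Longrightarrow> i < b \<Longrightarrow> (g i, g (i + 1)) \<in> R"
    using patch_walk[of f a b] D walk unfolding f_def by blast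
  have fz: "f i = z i" if "i \<in> T \<or> (i \<in> {1..n} - \<Lambda> \<and> (i + 1 \<in> T \<or> (\<exists>j\<in>T. i = j + 1)))" for i
    using that hb_outside[OF assms(4,1)] bd assms(5) by (cases "i \<in> T") (auto simp: f_def)
  have "(g i, g (i + 1)) \<in> R" if i: "1 \<le> i" "i < n" "i \<in> \<Lambda> \<or> i + 1 \<in> \<Lambda>" for i
  proof (cases "a \<le> i \<and> i < b")
    case False
    then have notD: "i \<notin> {a<..<b}" "i + 1 \<notin> {a<..<b}" by auto
    then have iT: "i \<in> T \<or> i \<notin> \<Lambda>" "i + 1 \<in> T \<or> i + 1 \<notin> \<Lambda>" using D(1) by blast+
    have "g i = f i" "g (i + 1) = f (i + 1)" using g(2) notD by auto
    moreover have "f i = z i" "f (i + 1) = z (i + 1)"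
      using i iT by (auto intro!: fz)
    ultimately show ?thesis using hb_edge[OF assms(4) i] by simp
  qed (use g(3) in blast)
  moreover have "g i = y i" if "i \<in> {1..n} - \<Lambda>" for i
  proof -
    have "i \<notin> {a<..<b}" "i \<notin> T" using that D(1) assms(5) by blast+
    then show ?thesis using g(2) by (simp add: f_def)
  qed
  ultimately have "g \<in> hb \<Lambda> y" using g(1) by (auto simp: heat_bath_set_def)
  moreover have "g i = z i" if "i \<in> T" for i
  proof -
    have "i \<notin> {a<..<b}" using that D(1) by blast
    then show ?thesis using g(2) that by (simp add: f_def)
  qed
  ultimately show ?thesis by blast
qed

lemma restrict_image_eqI:
  assumes "\<And>z. z \<in> A \<Longrightarrow> \<exists>z'\<in>B. \<forall>i\<in>T. z' i = z i" "\<And>z. z \<in> B \<Longrightarrow> \<exists>z'\<in>A. \<forall>i\<in>T. z' i = z i"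
  shows "(\<lambda>z. restrict z T) ` A = (\<lambda>z. restrict z T) ` B"
proof -
  have "(\<lambda>z. restrict z T) ` A \<subseteq> (\<lambda>z. restrict z T) ` B"
    if AB: "\<And>z. z \<in> A \<Longrightarrow> \<exists>z'\<in>B. \<forall>i\<in>T. z' i = z i" for A B
  proof
    fix t assume "t \<in> (\<lambda>z. restrict z T) ` A"
    then obtain z where z: "z \<in> A" "t = restrict z T" by auto
    then obtain z' where "z' \<in> B" "\<forall>i\<in>T. z' i = z i" using AB by blast
    then have "t = restrict z' T" using z(2) by (auto simp: restrict_def)
    then show "t \<in> (\<lambda>z. restrict z T) ` B" using \<open>z' \<in> B\<close> by blast
  qed
  from this[of A B] this[of B A] show ?thesis using assms by blast
qed

text \<open>A member of the fibre is determined by its colours on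
  \<open>\<Lambda> - T\<close>.\<close>

lemma fibre_card:
  assumes "\<Lambda> \<subseteq> {1..n}" "x \<in> conf"
  shows "card {z \<in> hb \<Lambda> x. restrict z T = t} \<le> q ^ card (\<Lambda> - T)"
proof -
  let ?A = "{z \<in> hb \<Lambda> x. restrict z T = t}"
  have fin: "finite (\<Lambda> - T)" using assms(1) finite_subset by blast
  have "inj_on (\<lambda>z. restrict z (\<Lambda> - T)) ?A"
  proof (rule inj_onI, rule ext)
    fix z z' i assume z: "z \<in> ?A" "z' \<in> ?A" and eq: "restrict z (\<Lambda> - T) = restrict z' (\<Lambda> - T)"
    consider "i \<in> T" | "i \<in> \<Lambda> - T" | "i \<notin> \<Lambda>" by blast
    then show "z i = z' i"
    proof cases
      case 1
      have "restrict z T i = restrict z' T i" using z by simp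
      then show ?thesis using 1 by simp
    next
      case 2
      then show ?thesis using fun_cong[OF eq, of i] by simp
    next
      case 3
      then show ?thesis using z hb_outside[of z \<Lambda> x i] hb_outside[of z' \<Lambda> x i] assms(2) by auto
    qed
  qed
  moreover have "(\<lambda>z. restrict z (\<Lambda> - T)) ` ?A \<subseteq> (\<Lambda> - T) \<rightarrow>\<^sub>E V"
  proof (rule image_subsetI)
    fix z assume z: "z \<in> ?A"
    have "z i \<in> V" if "i \<in> \<Lambda> - T" for i
      using that assms(1) z conf_V[of z i] hb_conf[of z \<Lambda> x] by auto
    then show "restrict z (\<Lambda> - T) \<in> (\<Lambda> - T) \<rightarrow>\<^sub>E V" by auto
  qed
  moreover have "finite ((\<Lambda> - T) \<rightarrow>\<^sub>E V)" using fin finite_V by (intro finite_PiE) auto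
  ultimately have "card ?A \<le> card ((\<Lambda> - T) \<rightarrow>\<^sub>E V)"
    by (rule card_inj_on_le)
  then show ?thesis using fin by (simp add: card_PiE)
qed

section \<open>Coupling two heat-bath moves segment by segment\<close>

definition dis :: "nat set \<Rightarrow> ((nat \<Rightarrow> 'c) \<times> (nat \<Rightarrow> 'c)) set" where
  "dis F = {(x, y). \<exists>i\<in>F. x i \<noteq> y i}"

lemma restriction_coupling:
  assumes "x \<in> conf" "y \<in> conf" "\<Lambda> \<subseteq> {1..n}" "hb \<Lambda> x \<noteq> {}" "card (\<Lambda> - T) \<le> m"
    and "(\<lambda>z. restrict z T) ` hb \<Lambda> x = (\<lambda>z. restrict z T) ` hb \<Lambda> y"
  obtains \<kappa> where "\<kappa> \<in> couplings (U \<Lambda> x) (U \<Lambda> y)"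
    "measure_pmf.prob \<kappa> (dis T) \<le> 1 - 1 / real q ^ m"
proof -
  have le: "q ^ card (\<Lambda> - T) \<le> q ^ m"
    using assms(5) q_pos by (intro power_increasing) auto
  obtain \<kappa> where \<kappa>: "\<kappa> \<in> couplings (U \<Lambda> x) (U \<Lambda> y)"
    "measure_pmf.prob \<kappa> {(z, z'). restrict z T \<noteq> restrict z' T} \<le> 1 - 1 / real (q ^ m)"
    using uniform_fibre_coupling[OF finite_hb assms(4) finite_hb assms(6), of "q ^ m"] q_pos
      le_trans[OF fibre_card[OF assms(3,1)] le] le_trans[OF fibre_card[OF assms(3,2)] le] by auto
  moreover have "dis T = {(z, z'). restrict z T \<noteq> restrict z' T}"
    unfolding dis_def by (auto simp: restrict_def fun_eq_iff)
  ultimately show thesis by (intro that) auto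
qed

lemma same_boundary_coupling:
  assumes "x \<in> conf" "y \<in> conf" "\<Lambda> \<subseteq> {1..n}" "hb \<Lambda> x \<noteq> {}"
    and "\<And>i j. i \<in> \<Lambda> \<Longrightarrow> j \<in> {1..n} - \<Lambda> \<Longrightarrow> j = i + 1 \<or> i = j + 1 \<Longrightarrow> x j = y j"
  obtains \<kappa> where "\<kappa> \<in> couplings (U \<Lambda> x) (U \<Lambda> y)" "measure_pmf.prob \<kappa> (dis \<Lambda>) = 0"
proof -
  have "(\<lambda>z. restrict z \<Lambda>) ` hb \<Lambda> x = (\<lambda>z. restrict z \<Lambda>) ` hb \<Lambda> y"
    using transfer_same[OF assms(1-3) _ assms(5)] transfer_same[OF assms(2,1,3) _ assms(5)[symmetric]]
    by (intro restrict_image_eqI) auto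
  \<comment> \<open>With \<open>T = \<Lambda>\<close> nothing is left free, and for
    \<open>m = 0\<close> the bound is 1 - 1 = 0.\<close>
  from restriction_coupling[OF assms(1-4) _ this, of 0] that show thesis
    by (metis Diff_cancel card.empty diff_self div_by_1 le_refl measure_le_0_iff power_0)
qed

text \<open>
  A heat-bath move on \<open>\<Lambda>\<close> followed by one on a subset \<open>\<Lambda>'\<close> has the law of the first alone
  (\<open>resample\<close>).  So after coupling on \<open>T\<close> one may redraw \<open>\<Lambda>'\<close>: identically if the
  copies agree on \<open>T\<close>, recursively if they do not.
\<close>

lemma coupling_step:
  assumes "x \<in> conf" "y \<in> conf" "\<Lambda> \<subseteq> {1..n}" "hb \<Lambda> x \<noteq> {}" "hb \<Lambda> y \<noteq> {}"
    and sub: "T \<subseteq> \<Lambda>" "\<Lambda>' \<subseteq> T" "F \<subseteq> T" and card: "card (\<Lambda> - T) \<le> m"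
    and img: "(\<lambda>z. restrict z T) ` hb \<Lambda> x = (\<lambda>z. restrict z T) ` hb \<Lambda> y"
    and bd: "\<And>i j. i \<in> \<Lambda>' \<Longrightarrow> j \<in> {1..n} - \<Lambda>' \<Longrightarrow> j = i + 1 \<or> i = j + 1 \<Longrightarrow>
      j \<in> T \<or> j \<notin> \<Lambda> \<and> x j = y j"
    and rec: "\<And>x' y'. x' \<in> hb \<Lambda> x \<Longrightarrow> y' \<in> hb \<Lambda> y \<Longrightarrow>
      \<exists>\<kappa>\<in>couplings (U \<Lambda>' x') (U \<Lambda>' y'). measure_pmf.prob \<kappa> (dis F) \<le> \<eta>"
  shows "\<exists>\<kappa>\<in>couplings (U \<Lambda> x) (U \<Lambda> y). measure_pmf.prob \<kappa> (dis F) \<le> (1 - 1 / real q ^ m) * \<eta>"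
proof -
  obtain \<kappa> where \<kappa>: "\<kappa> \<in> couplings (U \<Lambda> x) (U \<Lambda> y)"
    "measure_pmf.prob \<kappa> (dis T) \<le> 1 - 1 / real q ^ m"
    using restriction_coupling[OF assms(1-4) card img] .
  have supp: "fst z \<in> hb \<Lambda> x" "snd z \<in> hb \<Lambda> y" if "z \<in> set_pmf \<kappa>" for z
    using couplings_support[OF \<kappa>(1) that] assms(4,5) finite_hb by auto
  have \<Lambda>': "\<Lambda>' \<subseteq> {1..n}" "\<Lambda>' \<subseteq> \<Lambda>" using assms(3) sub by auto
  have ex: "\<exists>k\<in>couplings (U \<Lambda>' (fst z)) (U \<Lambda>' (snd z)).
      measure_pmf.prob k (dis F) \<le> (if z \<in> dis T then \<eta> else 0)" if z: "z \<in> set_pmf \<kappa>" for z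
  proof (cases "z \<in> dis T")
    case True
    then show ?thesis using rec[OF supp[OF z]] by simp
  next
    case False
    have eq: "fst z i = snd z i" if "i \<in> T" for i
      using False that by (auto simp: dis_def case_prod_unfold)
    have c: "fst z \<in> conf" "snd z \<in> conf" using supp[OF z] hb_conf by auto
    have ne: "hb \<Lambda>' (fst z) \<noteq> {}" "hb \<Lambda>' (snd z) \<noteq> {}"
      using hb_refine[OF \<Lambda>'(2) supp(1)[OF z]] hb_refine[OF \<Lambda>'(2) supp(2)[OF z]] by auto
    obtain k where k: "k \<in> couplings (U \<Lambda>' (fst z)) (U \<Lambda>' (snd z))"
      "measure_pmf.prob k (dis \<Lambda>') = 0"
    proof (rule same_boundary_coupling[OF c \<Lambda>'(1) ne(1)])
      fix i j assume ij: "i \<in> \<Lambda>'" "j \<in> {1..n} - \<Lambda>'" "j = i + 1 \<or> i = j + 1"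
      from bd[OF this] show "fst z j = snd z j"
        using eq hb_outside[OF supp(1)[OF z] assms(1)] hb_outside[OF supp(2)[OF z] assms(2)] by auto
    qed
    \<comment> \<open>The copies agree on \<open>T\<close>, which contains \<open>F\<close>, and
      redrawing touches only \<open>\<Lambda>'\<close>; a disagreement on \<open>F\<close> must
      therefore lie in \<open>\<Lambda>'\<close>.\<close>
    have "measure_pmf.prob k (dis F) \<le> measure_pmf.prob k (dis \<Lambda>')"
    proof (rule measure_pmf.finite_measure_mono_AE)
      show "AE w in measure_pmf k. w \<in> dis F \<longrightarrow> w \<in> dis \<Lambda>'"
        unfolding AE_measure_pmf_iff
      proof (intro ballI impI)
        fix w assume w: "w \<in> set_pmf k" "w \<in> dis F"
        then obtain i where i: "i \<in> F" "fst w i \<noteq> snd w i" by (auto simp: dis_def)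
        have "fst w \<in> hb \<Lambda>' (fst z)" "snd w \<in> hb \<Lambda>' (snd z)"
          using couplings_support[OF k(1) w(1)] ne finite_hb by auto
        then have "i \<in> \<Lambda>'" using i eq[of i] sub(3) c hb_outside[of _ \<Lambda>' _ i]
          by (metis subsetD)
        then show "w \<in> dis \<Lambda>'" using i(2) by (auto simp: dis_def case_prod_unfold)
      qed
    qed simp
    then show ?thesis using k False by auto
  qed
  define K where "K z = (SOME k. k \<in> couplings (U \<Lambda>' (fst z)) (U \<Lambda>' (snd z)) \<and>
      measure_pmf.prob k (dis F) \<le> (if z \<in> dis T then \<eta> else 0))" for z
  have K: "K z \<in> couplings (U \<Lambda>' (fst z)) (U \<Lambda>' (snd z))"
    "measure_pmf.prob (K z) (dis F) \<le> (if z \<in> dis T then \<eta> else 0)" if "z \<in> set_pmf \<kappa>" for z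
    using someI_ex[OF ex[OF that, unfolded Bex_def]] unfolding K_def by auto
  obtain x' y' where "x' \<in> hb \<Lambda> x" "y' \<in> hb \<Lambda> y" using assms(4,5) by blast
  then have \<eta>: "0 \<le> \<eta>" using rec measure_nonneg order_trans by blast
  have "bind_pmf \<kappa> K \<in> couplings (bind_pmf (U \<Lambda> x) (U \<Lambda>')) (bind_pmf (U \<Lambda> y) (U \<Lambda>'))"
    using bind_couplings[OF \<kappa>(1), of K "U \<Lambda>'" "U \<Lambda>'"] K(1) by fastforce
  then have "bind_pmf \<kappa> K \<in> couplings (U \<Lambda> x) (U \<Lambda> y)"
    using resample \<Lambda>'(2) assms(4,5) by simp
  moreover have "measure_pmf.prob (bind_pmf \<kappa> K) (dis F)
      \<le> measure_pmf.expectation \<kappa> (\<lambda>z. if z \<in> dis T then \<eta> else 0)"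
    using K(2) \<eta>
    by (intro measure_pmf_bind_le measure_pmf.integrable_const_bound[where B = \<eta>]) auto
  moreover have "measure_pmf.expectation \<kappa> (\<lambda>z. if z \<in> dis T then \<eta> else 0)
      = measure_pmf.prob \<kappa> (dis T) * \<eta>"
  proof -
    have "(\<lambda>z. if z \<in> dis T then \<eta> else 0) = (\<lambda>z. indicator (dis T) z * \<eta>)"
      by (auto simp: indicator_def)
    then show ?thesis by simp
  qed
  ultimately show ?thesis using mult_right_mono[OF \<kappa>(2) \<eta>]
    by (intro bexI[of _ "bind_pmf \<kappa> K"]) linarith+
qed

text \<open>From here on a block is an open interval with boundary sites \<open>l\<close> and
  \<open>r\<close>; \<open>l = 0\<close> and \<open>r = n + 1\<close> stand for a missing boundary
  site at an end of the path.\<close>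

lemma hb_walk_left:
  assumes "x \<in> conf" "1 \<le> l" "r \<le> n + 1" "l + s < r" "z \<in> hb {l<..<r} x"
  shows "(x l, z (l + s)) \<in> R ^^ s"
proof -
  have "(z l, z (l + s)) \<in> R ^^ (l + s - l)"
    using assms(2-4) by (intro walk_along hb_edge[OF assms(5)]) auto
  then show ?thesis using hb_outside[OF assms(5,1), of l] by simp
qed

lemma hb_walk_right:
  assumes "x \<in> conf" "r \<le> n" "l + s < r" "z \<in> hb {l<..<r} x"
  shows "(x r, z (r - s)) \<in> R ^^ s"
proof -
  have "(z i, z (i + 1)) \<in> R" if "r - s \<le> i" "i < r" for i
  proof -
    have "l < i" using that assms(3) by linarith
    then have "1 \<le> i" "i < n" "i \<in> {l<..<r}" using that(2) assms(2) by auto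
    then show ?thesis using hb_edge[OF assms(4)] by blast
  qed
  then have "(z (r - s), z r) \<in> R ^^ (r - (r - s))"
    by (intro walk_along) simp_all
  then show ?thesis
    using assms(3) relpow_symD[OF sym_R, of "z (r - s)" "z r" s] hb_outside[OF assms(4,1), of r]
    by simp
qed

text \<open>The colour of \<open>z\<close> at \<open>l + s\<close> is kept. It is reached from
  \<open>x l\<close> in \<open>s\<close> steps, hence also from the even-linked \<open>y l\<close>,
  and that walk refills the first segment.\<close>

lemma left_transfer:
  assumes "x \<in> conf" "y \<in> conf" "1 \<le> l" "r \<le> n + 1" "l + s < r"
    and "(x l, y l) \<in> even_linked R" "r \<le> n \<Longrightarrow> x r = y r" "z \<in> hb {l<..<r} x"
  shows "\<exists>z'\<in>hb {l<..<r} y. \<forall>i\<in>{l + s..<r}. z' i = z i"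
proof (rule transfer_walk[OF assms(1,2) _ assms(8)])
  have "(y l, x l) \<in> even_linked R" using assms(6) by (rule even_linked_sym[OF sym_R])
  then have "(y l, z (l + s)) \<in> R ^^ s"
    using even_linked_walk[OF finite_V R_subset sym_R _ hb_walk_left[OF assms(1,3-5,8)]] s_pos s_ge
    by simp
  then show "(if l \<in> {l + s..<r} then z l else y l, if l + s \<in> {l + s..<r} then z (l + s) else y (l + s))
    \<in> R ^^ (l + s - l)" using assms(5) s_pos by simp
  fix i j assume "i \<in> {l + s..<r}" "j \<in> {1..n} - {l<..<r}" "j = i + 1 \<or> i = j + 1"
  then have "j = r" "r \<le> n" using assms(3-5) s_ge_2 by auto
  then show "x j = y j" using assms(7) by simp
qed (use assms s_pos in auto)

lemma right_transfer:
  assumes "x \<in> conf" "y \<in> conf" "r \<le> n" "l + s < r"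
    and "(x r, y r) \<in> even_linked R" "1 \<le> l \<Longrightarrow> x l = y l" "z \<in> hb {l<..<r} x"
  shows "\<exists>z'\<in>hb {l<..<r} y. \<forall>i\<in>{l<..r - s}. z' i = z i"
proof (rule transfer_walk[OF assms(1,2) _ assms(7)])
  have "(y r, x r) \<in> even_linked R" using assms(5) by (rule even_linked_sym[OF sym_R])
  then have "(y r, z (r - s)) \<in> R ^^ s"
    using even_linked_walk[OF finite_V R_subset sym_R _ hb_walk_right[OF assms(1,3,4,7)]] s_pos s_ge
    by simp
  then have "(z (r - s), y r) \<in> R ^^ s" by (rule relpow_symD[OF sym_R])
  then show "(if r - s \<in> {l<..r - s} then z (r - s) else y (r - s), if r \<in> {l<..r - s} then z r else y r)
    \<in> R ^^ (r - (r - s))" using assms(4) s_pos by auto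
  fix i j assume ij: "i \<in> {l<..r - s}" "j \<in> {1..n} - {l<..<r}" "j = i + 1 \<or> i = j + 1"
  then have "l < i" "i \<le> r - s" by simp_all
  \<comment> \<open>Since \<open>s\<close> is at least 2, no neighbour of \<open>i\<close> is
    \<open>r\<close>; only the boundary site \<open>l\<close> can occur.\<close>
  then have "i + 2 \<le> r" using assms(4) s_ge_2 by linarith
  then show "x j = y j" using ij(2,3) \<open>l < i\<close> assms(6) by (cases "j = l") auto
qed (use assms s_pos in auto)

text \<open>Each segment gives one factor. If coupling beyond the segment fails,
  \<open>l + s\<close> becomes the left boundary site of the smaller block; its two colours are
  again even-linked, and the right boundary colours still agree.\<close>

lemma left_coupling:
  assumes "x \<in> conf" "y \<in> conf" "1 \<le> l" "r \<le> n + 1" "l + s * j < r"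
    and "(x l, y l) \<in> even_linked R" "r \<le> n \<Longrightarrow> x r = y r"
    and "hb {l<..<r} x \<noteq> {}" "hb {l<..<r} y \<noteq> {}"
  shows "\<exists>\<kappa>\<in>couplings (U {l<..<r} x) (U {l<..<r} y).
    measure_pmf.prob \<kappa> (dis {l + s * j..<r}) \<le> (1 - 1 / real q ^ s) ^ j"
  using assms
proof (induction j arbitrary: x y l)
  case 0
  show ?case by (rule bexI[OF _ pair_pmf_couplings]) simp
next
  case (Suc j)
  note p = Suc.prems
  have ls: "l + s < r" using p(5) by simp
  have lt: "l + s + s * j < r" "{l + s * Suc j..<r} = {l + s + s * j..<r}" using p(5) by auto
  have D: "{l<..<r} - {l + s..<r} = {l<..<l + s}" using ls by auto
  have "\<exists>\<kappa>\<in>couplings (U {l<..<r} x) (U {l<..<r} y).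
    measure_pmf.prob \<kappa> (dis {l + s * Suc j..<r}) \<le> (1 - 1 / real q ^ s) * (1 - 1 / real q ^ s) ^ j"
  proof (rule coupling_step[where T = "{l + s..<r}" and \<Lambda>' = "{l + s<..<r}", OF p(1,2) _ p(8,9)])
    show "(\<lambda>z. restrict z {l + s..<r}) ` hb {l<..<r} x = (\<lambda>z. restrict z {l + s..<r}) ` hb {l<..<r} y"
      using left_transfer[OF p(1-4) ls p(6,7)]
        left_transfer[OF p(2,1,3,4) ls even_linked_sym[OF sym_R p(6)] p(7)[symmetric]]
      by (intro restrict_image_eqI) auto
    \<comment> \<open>The gap has \<open>s - 1\<close> sites, as \<open>l + s\<close> itself is
      among the coupled ones.\<close>
    show "card ({l<..<r} - {l + s..<r}) \<le> s" unfolding D by simp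
    fix i k assume "i \<in> {l + s<..<r}" "k \<in> {1..n} - {l + s<..<r}" "k = i + 1 \<or> i = k + 1"
    then have "k = l + s \<or> k = r \<and> r \<le> n" by auto
    then show "k \<in> {l + s..<r} \<or> k \<notin> {l<..<r} \<and> x k = y k" using p(7) ls by auto
  next
    fix x' y' assume x': "x' \<in> hb {l<..<r} x" and y': "y' \<in> hb {l<..<r} y"
    have "(x' (l + s), y' (l + s)) \<in> even_linked R"
      using even_linked_step[OF sym_R p(6) hb_walk_left[OF p(1,3,4) ls x'] hb_walk_left[OF p(2-4) ls y']] .
    moreover have "x' r = y' r" if "r \<le> n"
      using hb_outside[OF x' p(1), of r] hb_outside[OF y' p(2), of r] p(7)[OF that] by simp
    moreover have "hb {l + s<..<r} x' \<noteq> {}" "hb {l + s<..<r} y' \<noteq> {}"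
      using hb_refine[OF _ x', of "{l + s<..<r}"] hb_refine[OF _ y', of "{l + s<..<r}"] by fastforce+
    ultimately show "\<exists>\<kappa>\<in>couplings (U {l + s<..<r} x') (U {l + s<..<r} y').
        measure_pmf.prob \<kappa> (dis {l + s * Suc j..<r}) \<le> (1 - 1 / real q ^ s) ^ j"
      unfolding lt(2) using p(3,4) lt(1) hb_conf[OF x'] hb_conf[OF y']
      by (intro Suc.IH) auto
  qed (use p(3,4) s_pos in auto)
  then show ?case by simp
qed

lemma right_coupling:
  assumes "x \<in> conf" "y \<in> conf" "r \<le> n" "l + s * j < r"
    and "(x r, y r) \<in> even_linked R" "1 \<le> l \<Longrightarrow> x l = y l"
    and "hb {l<..<r} x \<noteq> {}" "hb {l<..<r} y \<noteq> {}"
  shows "\<exists>\<kappa>\<in>couplings (U {l<..<r} x) (U {l<..<r} y).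
    measure_pmf.prob \<kappa> (dis {l<..r - s * j}) \<le> (1 - 1 / real q ^ s) ^ j"
  using assms
proof (induction j arbitrary: x y r)
  case 0
  show ?case by (rule bexI[OF _ pair_pmf_couplings]) simp
next
  case (Suc j)
  note p = Suc.prems
  have ls: "l + s < r" using p(4) by simp
  have lt: "l + s * j < r - s" "{l<..r - s * Suc j} = {l<..r - s - s * j}" using p(4) by auto
  have D: "{l<..<r} - {l<..r - s} = {r - s<..<r}" using ls by auto
  have "\<exists>\<kappa>\<in>couplings (U {l<..<r} x) (U {l<..<r} y).
    measure_pmf.prob \<kappa> (dis {l<..r - s * Suc j}) \<le> (1 - 1 / real q ^ s) * (1 - 1 / real q ^ s) ^ j"
  proof (rule coupling_step[where T = "{l<..r - s}" and \<Lambda>' = "{l<..<r - s}", OF p(1,2) _ p(7,8)])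
    show "(\<lambda>z. restrict z {l<..r - s}) ` hb {l<..<r} x = (\<lambda>z. restrict z {l<..r - s}) ` hb {l<..<r} y"
      using right_transfer[OF p(1-3) ls p(5,6)]
        right_transfer[OF p(2,1,3) ls even_linked_sym[OF sym_R p(5)] p(6)[symmetric]]
      by (intro restrict_image_eqI) auto
    show "card ({l<..<r} - {l<..r - s}) \<le> s" unfolding D using ls by simp
    fix i k assume "i \<in> {l<..<r - s}" "k \<in> {1..n} - {l<..<r - s}" "k = i + 1 \<or> i = k + 1"
    then have "k = r - s \<or> k = l \<and> 1 \<le> l" by auto
    then show "k \<in> {l<..r - s} \<or> k \<notin> {l<..<r} \<and> x k = y k" using p(6) ls by auto
  next
    fix x' y' assume x': "x' \<in> hb {l<..<r} x" and y': "y' \<in> hb {l<..<r} y"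
    have "(x' (r - s), y' (r - s)) \<in> even_linked R"
      using even_linked_step[OF sym_R p(5) hb_walk_right[OF p(1,3) ls x'] hb_walk_right[OF p(2,3) ls y']] .
    moreover have "x' l = y' l" if "1 \<le> l"
      using hb_outside[OF x' p(1), of l] hb_outside[OF y' p(2), of l] p(6)[OF that] by simp
    moreover have "hb {l<..<r - s} x' \<noteq> {}" "hb {l<..<r - s} y' \<noteq> {}"
      using hb_refine[OF _ x', of "{l<..<r - s}"] hb_refine[OF _ y', of "{l<..<r - s}"] by fastforce+
    ultimately show "\<exists>\<kappa>\<in>couplings (U {l<..<r - s} x') (U {l<..<r - s} y').
        measure_pmf.prob \<kappa> (dis {l<..r - s * Suc j}) \<le> (1 - 1 / real q ^ s) ^ j"
      unfolding lt(2) using p(3) lt(1) hb_conf[OF x'] hb_conf[OF y']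
      by (intro Suc.IH) auto
  qed (use p(3) s_pos in auto)
  then show ?case by simp
qed

lemma same_ends_coupling:
  assumes "x \<in> conf" "y \<in> conf" "r \<le> n + 1" "hb {l<..<r} x \<noteq> {}"
    and "1 \<le> l \<Longrightarrow> x l = y l" "r \<le> n \<Longrightarrow> x r = y r"
  obtains \<kappa> where "\<kappa> \<in> couplings (U {l<..<r} x) (U {l<..<r} y)"
    "\<And>F. F \<subseteq> {l<..<r} \<Longrightarrow> measure_pmf.prob \<kappa> (dis F) = 0"
proof -
  have sub: "{l<..<r} \<subseteq> {1..n}" using assms(3) by auto
  have bd: "x k = y k" if "i \<in> {l<..<r}" "k \<in> {1..n} - {l<..<r}" "k = i + 1 \<or> i = k + 1" for i k
  proof -
    have "k = r \<and> r \<le> n \<or> k = l \<and> 1 \<le> l" using that by auto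
    then show ?thesis using assms(5,6) by auto
  qed
  obtain \<kappa> where \<kappa>: "\<kappa> \<in> couplings (U {l<..<r} x) (U {l<..<r} y)"
      "measure_pmf.prob \<kappa> (dis {l<..<r}) = 0"
    by (rule same_boundary_coupling[OF assms(1,2) sub assms(4)]) (use bd in blast)
  have "measure_pmf.prob \<kappa> (dis F) = 0" if "F \<subseteq> {l<..<r}" for F
  proof -
    have "measure_pmf.prob \<kappa> (dis F) \<le> measure_pmf.prob \<kappa> (dis {l<..<r})"
      by (rule measure_pmf.finite_measure_mono) (use that in \<open>auto simp: dis_def\<close>)
    then show ?thesis using \<kappa>(2) by (simp add: measure_le_0_iff)
  qed
  with \<kappa>(1) show thesis by (rule that)
qed

text \<open>Writing the bounds with the indicator of disagreement at \<open>l\<close> makes them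
  linear in it, so that they can later be averaged over the pair of states. The second bound serves
  the sites too close to \<open>l\<close> for the first.\<close>

lemma left_coupling_indicator:
  assumes "x \<in> conf" "y \<in> conf" "r \<le> n + 1" "l + s * j < r" "1 \<le> j"
    and "1 \<le> l \<Longrightarrow> (x l, y l) \<in> even_linked R" "r \<le> n \<Longrightarrow> x r = y r"
    and "hb {l<..<r} x \<noteq> {}" "hb {l<..<r} y \<noteq> {}"
  shows "\<exists>\<kappa>\<in>couplings (U {l<..<r} x) (U {l<..<r} y).
    measure_pmf.prob \<kappa> (dis {l + s * j..<r}) \<le> (1 - 1 / real q ^ s) ^ j * of_bool (1 \<le> l \<and> x l \<noteq> y l) \<and>
    measure_pmf.prob \<kappa> (dis {l<..<r}) \<le> of_bool (1 \<le> l \<and> x l \<noteq> y l)"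
proof (cases "1 \<le> l \<and> x l \<noteq> y l")
  case True
  then show ?thesis
    using left_coupling[OF assms(1,2) _ assms(3,4) _ assms(7-9)] assms(6) by auto
next
  case False
  then obtain \<kappa> where "\<kappa> \<in> couplings (U {l<..<r} x) (U {l<..<r} y)"
      "\<And>F. F \<subseteq> {l<..<r} \<Longrightarrow> measure_pmf.prob \<kappa> (dis F) = 0"
    using same_ends_coupling[OF assms(1-3,8) _ assms(7)] by blast
  moreover have "{l + s * j..<r} \<subseteq> {l<..<r}"
  proof -
    have "0 < s * j" using s_pos assms(5) by simp
    then show ?thesis
      unfolding subset_iff greaterThanLessThan_iff atLeastLessThan_iff by linarith
  qed
  ultimately show ?thesis using False by (intro bexI[of _ \<kappa>]) auto
qed

lemma right_coupling_indicator:
  assumes "x \<in> conf" "y \<in> conf" "r \<le> n + 1" "l + s * j < r" "1 \<le> j"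
    and "r \<le> n \<Longrightarrow> (x r, y r) \<in> even_linked R" "1 \<le> l \<Longrightarrow> x l = y l"
    and "hb {l<..<r} x \<noteq> {}" "hb {l<..<r} y \<noteq> {}"
  shows "\<exists>\<kappa>\<in>couplings (U {l<..<r} x) (U {l<..<r} y).
    measure_pmf.prob \<kappa> (dis {l<..r - s * j}) \<le> (1 - 1 / real q ^ s) ^ j * of_bool (r \<le> n \<and> x r \<noteq> y r) \<and>
    measure_pmf.prob \<kappa> (dis {l<..<r}) \<le> of_bool (r \<le> n \<and> x r \<noteq> y r)"
proof (cases "r \<le> n \<and> x r \<noteq> y r")
  case True
  then show ?thesis
    using right_coupling[OF assms(1,2) _ assms(4) _ assms(7-9)] assms(6) by auto
next
  case False
  then obtain \<kappa> where "\<kappa> \<in> couplings (U {l<..<r} x) (U {l<..<r} y)"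
      "\<And>F. F \<subseteq> {l<..<r} \<Longrightarrow> measure_pmf.prob \<kappa> (dis F) = 0"
    using same_ends_coupling[OF assms(1-3,8,7)] by blast
  moreover have "{l<..r - s * j} \<subseteq> {l<..<r}"
  proof -
    have "0 < s * j" using s_pos assms(5) by simp
    then show ?thesis
      using assms(4) unfolding subset_iff greaterThanLessThan_iff greaterThanAtMost_iff by linarith
  qed
  ultimately show ?thesis using False by (intro bexI[of _ \<kappa>]) auto
qed

section \<open>The state space as a parity class\<close>

lemma bipartition_sym: "bipartition H C1 C2 \<Longrightarrow> bipartition H C2 C1"
  unfolding bipartition_def by blast

lemma bipartition_walk:
  assumes "bipartition H C1 C2" "u \<in> C1" "(u, v) \<in> R ^^ k"
  shows "v \<in> (if even k then C1 else C2)"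
  using assms(3)
proof (induction k arbitrary: v)
  case 0
  then show ?case using assms(2) by simp
next
  case (Suc k)
  then obtain w where "(u, w) \<in> R ^^ k" "(w, v) \<in> R" by auto
  then show ?case using Suc.IH[of w] assms(1)
    unfolding bipartition_def by (fastforce split: if_splits)
qed

lemma bipartition_even_linked:
  assumes "bipartition H C1 C2" "u \<in> C1" "v \<in> V"
  shows "(u, v) \<in> even_linked R \<longleftrightarrow> v \<in> C1"
proof
  assume "(u, v) \<in> even_linked R"
  then obtain k where "even k" "(u, v) \<in> R ^^ k" unfolding even_linked_def by blast
  then show "v \<in> C1" using bipartition_walk[OF assms(1,2), of v k] by simp
next
  assume v: "v \<in> C1"
  have "u \<in> V" using assms(1,2) by (auto simp: bipartition_def)
  then obtain k where k: "(u, v) \<in> R ^^ k" using reach assms(3) by blast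
  have "C1 \<inter> C2 = {}" using assms(1) by (simp add: bipartition_def)
  then have "even k" using bipartition_walk[OF assms(1,2) k] v by (auto split: if_splits)
  then show "(u, v) \<in> even_linked R" using k unfolding even_linked_def by blast
qed

text \<open>If \<open>v\<close> is not even-linked to \<open>u\<close>, there is no odd closed walk
  at \<open>u\<close>, since it would switch the parity of walks from \<open>u\<close> to
  \<open>v\<close>. Then the colours even-linked to \<open>u\<close> and the others form a
  bipartition.\<close>

lemma even_linked_not_bipartite:
  assumes "\<not> bipartite H" "u \<in> V" "v \<in> V"
  shows "(u, v) \<in> even_linked R"
proof (rule ccontr)
  assume not: "(u, v) \<notin> even_linked R"
  define C1 where "C1 = {w \<in> V. (u, w) \<in> even_linked R}"
  have no_odd: "odd k \<Longrightarrow> (u, u) \<notin> R ^^ k" for k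
  proof
    assume k: "odd k" "(u, u) \<in> R ^^ k"
    obtain j where j: "(u, v) \<in> R ^^ j" using reach assms(2,3) by blast
    then have "(u, v) \<in> R ^^ (k + j)" using k(2) by (rule relpow_trans[rotated])
    then have "even j \<or> even (k + j) \<Longrightarrow> False"
      using j not unfolding even_linked_def by blast
    then show False using k(1) by auto
  qed
  have "(a \<in> C1 \<and> b \<in> V - C1) \<or> (a \<in> V - C1 \<and> b \<in> C1)" if ab: "(a, b) \<in> R" for a b
  proof -
    have V: "a \<in> V" "b \<in> V" using ab R_subset by auto
    have False if C: "a \<in> C1" "b \<in> C1"
    proof -
      obtain i j where ij: "even i" "(u, a) \<in> R ^^ i" "even j" "(u, b) \<in> R ^^ j"
        using C unfolding C1_def even_linked_def by auto
      have "(u, b) \<in> R ^^ Suc i" using ij(2) ab by (rule relpow_Suc_I)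
      moreover have "(b, u) \<in> R ^^ j" using ij(4) by (rule relpow_symD[OF sym_R])
      ultimately have "(u, u) \<in> R ^^ (Suc i + j)" by (rule relpow_trans)
      then show False using no_odd[of "Suc i + j"] ij by simp
    qed
    moreover have "b \<in> C1" if "a \<notin> C1"
    proof -
      obtain k where k: "(u, a) \<in> R ^^ k" using reach assms(2) V(1) by blast
      then have "odd k" using that V(1) unfolding C1_def even_linked_def by blast
      moreover have "(u, b) \<in> R ^^ Suc k" using k ab by (rule relpow_Suc_I)
      ultimately show ?thesis using V(2) unfolding C1_def even_linked_def
        by (auto intro!: exI[of _ "Suc k"])
    qed
    ultimately show ?thesis using V by blast
  qed
  then have "bipartition H C1 (V - C1)" unfolding bipartition_def by (auto simp: C1_def)
  then show False using assms(1) unfolding bipartite_def by blast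
qed

lemma colourings_conf: "x \<in> colourings H n \<Longrightarrow> x \<in> conf"
  by (simp add: colourings_def)

text \<open>The definition quantifies over bipartitions, but connectedness makes the colour class of
  \<open>x 1\<close> independent of the one chosen.\<close>

lemma state_space_eq:
  assumes "is_state_space H n S" "x \<in> S" "1 \<le> n"
  shows "S = {y \<in> colourings H n. (x 1, y 1) \<in> even_linked R}"
proof -
  have S: "S \<subseteq> colourings H n" using assms(1) unfolding is_state_space_def by (auto split: if_splits)
  have V: "y 1 \<in> V" if "y \<in> colourings H n" for y
    using conf_V[OF colourings_conf[OF that]] assms(3) by simp
  show ?thesis
  proof (cases "bipartite H")
    case True
    then obtain C1 C2 where "bipartition H C1 C2"
        "S = {x \<in> colourings H n. x 1 \<in> C1} \<or> S = {x \<in> colourings H n. x 1 \<in> C2}"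
      using assms(1) unfolding is_state_space_def by auto
    then obtain C C' where C: "bipartition H C C'" "S = {x \<in> colourings H n. x 1 \<in> C}"
      using bipartition_sym by blast
    then show ?thesis using bipartition_even_linked[OF C(1), of "x 1"] assms(2) V by auto
  next
    case False
    then have "S = colourings H n" using assms(1) by (simp add: is_state_space_def)
    then show ?thesis using even_linked_not_bipartite[OF False] V assms(2) by auto
  qed
qed

lemma colouring_walk:
  assumes "x \<in> colourings H n" "1 \<le> a" "a \<le> b" "b \<le> n"
  shows "(x a, x b) \<in> R ^^ (b - a)"
  using assms by (intro walk_along) (auto simp: colourings_def)

end

section \<open>Moves of the chain on its state space, and the coupling of one block move\<close>

locale colour_chain = colour_path +
  fixes S :: "(nat \<Rightarrow> 'a) set"
  assumes state_space: "is_state_space H n S" and n_pos: "1 \<le> n"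
begin

lemma S_colourings: "x \<in> S \<Longrightarrow> x \<in> colourings H n"
  using state_space unfolding is_state_space_def by (auto split: if_splits)

lemma S_conf: "x \<in> S \<Longrightarrow> x \<in> conf"
  using S_colourings colourings_conf by blast

lemma finite_S: "finite S"
  using finite_conf S_conf by (meson finite_subset subsetI)

lemma S_even_linked:
  assumes "x \<in> S" "y \<in> S" "1 \<le> i" "i \<le> n"
  shows "(x i, y i) \<in> even_linked R"
proof -
  have "(x 1, y 1) \<in> even_linked R"
    using state_space_eq[OF state_space assms(1) n_pos] assms(2) by blast
  then show ?thesis
    using even_linked_step[OF sym_R] colouring_walk[OF S_colourings[OF assms(1)], of 1 i]
      colouring_walk[OF S_colourings[OF assms(2)], of 1 i] assms(3,4) by simp
qed

text \<open>A site left fixed pins the parity class: walking back from it to site 1 takes equally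
  many steps in \<open>x\<close> and in \<open>y\<close>.\<close>

lemma hb_subset_S:
  assumes "x \<in> S" "\<Lambda> \<subseteq> {1..n}" "\<Lambda> \<noteq> {1..n}"
  shows "hb \<Lambda> x \<subseteq> S"
proof
  fix y assume y: "y \<in> hb \<Lambda> x"
  have x: "x \<in> colourings H n" "x \<in> conf" using assms(1) S_colourings S_conf by auto
  have "(y i, y (i + 1)) \<in> R" if "1 \<le> i" "i < n" for i
    using that hb_edge[OF y that] hb_outside[OF y x(2), of i] hb_outside[OF y x(2), of "i + 1"] x(1)
    by (cases "i \<in> \<Lambda> \<or> i + 1 \<in> \<Lambda>") (auto simp: colourings_def)
  then have y_col: "y \<in> colourings H n" using hb_conf[OF y] by (auto simp: colourings_def)
  obtain i where "i \<in> {1..n}" and i: "i \<notin> \<Lambda>" using assms(2,3) by blast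
  then have i: "1 \<le> i" "i \<le> n" "i \<notin> \<Lambda>" by auto
  have "(x i, y i) \<in> even_linked R" using hb_outside[OF y x(2) i(3)] even_linked_refl by metis
  moreover have "(x i, x 1) \<in> R ^^ (i - 1)" "(y i, y 1) \<in> R ^^ (i - 1)"
    using colouring_walk[OF x(1), of 1 i] colouring_walk[OF y_col, of 1 i] i
    by (auto intro: relpow_symD[OF sym_R])
  ultimately have "(x 1, y 1) \<in> even_linked R" by (rule even_linked_step[OF sym_R])
  then show "y \<in> S" using state_space_eq[OF state_space assms(1) n_pos] y_col by blast
qed

lemma heat_bath_proper:
  assumes "x \<in> S" "\<Lambda> \<subseteq> {1..n}" "\<Lambda> \<noteq> {1..n}"
  shows "heat_bath H n S \<Lambda> x = U \<Lambda> x"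
  using hb_subset_S[OF assms] by (simp add: heat_bath_def Int_absorb2)

lemma heat_bath_whole:
  assumes "x \<in> S" shows "heat_bath H n S {1..n} x = pmf_of_set S"
proof -
  have "S \<subseteq> hb {1..n} x"
    using S_colourings by (auto simp: heat_bath_set_def colourings_def)
  then show ?thesis by (simp add: heat_bath_def Int_absorb1)
qed

lemma heat_bath_support:
  assumes "x \<in> S"
  shows "set_pmf (heat_bath H n S \<Lambda> x) = hb \<Lambda> x \<inter> S"
  unfolding heat_bath_def using assms hb_self[OF S_colourings] finite_S by (intro set_pmf_of_set) auto

lemma heat_bath_stationary:
  assumes "S \<noteq> {}"
  shows "bind_pmf (pmf_of_set S) (heat_bath H n S \<Lambda>) = pmf_of_set S"
  unfolding heat_bath_def
proof (rule bind_pmf_of_set_partition[OF finite_S assms])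
  show "x \<in> hb \<Lambda> x \<inter> S \<and> hb \<Lambda> x \<inter> S \<subseteq> S" if "x \<in> S" for x
    using that hb_self[OF S_colourings] by auto
  show "hb \<Lambda> y \<inter> S = hb \<Lambda> x \<inter> S" if "y \<in> hb \<Lambda> x \<inter> S" for x y
    using that hb_class by blast
qed


text \<open>The two couplings through the intermediate configuration are glued and their bounds add
  up. At the middle site \<open>l + s * j\<close> both terms carry the factor
  \<open>\<delta>\<close>; the proof of the scan bound depends on this.\<close>

lemma block_coupling:
  fixes \<delta> :: real and l r j :: nat
  assumes x: "x \<in> S" and y: "y \<in> S" and r: "r \<le> n + 1" and lr: "l + s * j < r"
    and r_eq: "r \<le> n \<Longrightarrow> r = l + 2 * (s * j) + 1" and j: "1 \<le> j"
    and \<delta>: "(1 - 1 / real q ^ s) ^ j \<le> \<delta>"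
  shows "\<exists>\<kappa>\<in>couplings (heat_bath H n S {l<..<r} x) (heat_bath H n S {l<..<r} y).
    (\<forall>i. measure_pmf.prob \<kappa> (dis {i}) \<le>
       (if i \<in> {l<..<r} then (if l + s * j \<le> i then \<delta> else 1) * of_bool (1 \<le> l \<and> x l \<noteq> y l)
          + (if i \<le> l + s * j then \<delta> else 1) * of_bool (r \<le> n \<and> x r \<noteq> y r)
        else of_bool (x i \<noteq> y i)))"
proof (cases "l = 0 \<and> r = n + 1")
  case True
  \<comment> \<open>A block that covers the path draws from the uniform law on \<open>S\<close> in
    both copies, so they can be made equal.\<close>
  then have eq: "{l<..<r} = {1..n}" by auto
  have 0: "measure_pmf.prob (map_pmf (\<lambda>x. (x, x)) p) (dis {i}) = 0" for p :: "(nat \<Rightarrow> 'a) pmf" and i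
    by (simp add: measure_map_pmf dis_def vimage_def)
  have "0 \<le> \<delta>" using q_pos by (intro order_trans[OF _ \<delta>]) simp
  then show ?thesis
    unfolding eq heat_bath_whole[OF x] heat_bath_whole[OF y]
    by (intro bexI[OF _ couplings_refl] allI) (simp only: 0, simp)
next
  case False
  let ?\<Lambda> = "{l<..<r}"
  have \<Lambda>: "?\<Lambda> \<subseteq> {1..n}" using r by auto
  have proper: "?\<Lambda> \<noteq> {1..n}"
  proof
    assume *: "?\<Lambda> = {1..n}"
    have "1 \<in> ?\<Lambda>" "n \<in> ?\<Lambda>" unfolding * using n_pos by auto
    then show False using False r by auto
  qed
  have xc: "x \<in> conf" "x \<in> colourings H n" and yc: "y \<in> conf" "y \<in> colourings H n"
    using x y S_conf S_colourings by auto
  have hb: "hb ?\<Lambda> x \<noteq> {}" "hb ?\<Lambda> y \<noteq> {}" using hb_self xc yc by blast+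
  \<comment> \<open>From \<open>x\<close> to \<open>w\<close> only the left boundary colour changes;
    from \<open>w\<close> to \<open>y\<close>, as seen from inside the block, only the right
    one.\<close>
  define w where "w i = (if i = l \<and> 1 \<le> l then y i else x i)" for i
  have ln: "l \<le> n" using lr r by linarith
  have w: "w \<in> conf"
    using conf_V[OF xc(1)] conf_V[OF yc(1)] conf_outside[OF xc(1)] ln
    by (intro confI) (auto simp: w_def)
  have wr: "w r = x r" using lr by (auto simp: w_def)
  have wl: "1 \<le> l \<Longrightarrow> w l = y l" by (simp add: w_def)
  have linked: "1 \<le> i \<Longrightarrow> i \<le> n \<Longrightarrow> (x i, y i) \<in> even_linked R" for i
    using S_even_linked[OF x y] .
  \<comment> \<open>The block must admit a filling for the mixed boundary. With at most one boundary
    site, a filling of \<open>x\<close> or of \<open>y\<close> serves; with two, parity and the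
    length \<open>r - l\<close> provide a walk from \<open>y l\<close> to
    \<open>x r\<close>.\<close>
  have hbw: "hb ?\<Lambda> w \<noteq> {}"
  proof -
    consider "l = 0" | "r = n + 1" | "1 \<le> l" "r \<le> n" using r by linarith
    then show ?thesis
    proof cases
      case 1
      then have "w = x" by (auto simp: w_def)
      then show ?thesis using hb by simp
    next
      case 2
      have "y k = w k" if "i \<in> ?\<Lambda>" "k \<in> {1..n} - ?\<Lambda>" "k = i + 1 \<or> i = k + 1" for i k
      proof -
        have "k = l" "1 \<le> l" using that 2 by auto
        then show ?thesis using wl by simp
      qed
      then show ?thesis using transfer_same[OF yc(1) w \<Lambda> hb_self[OF yc(2)]] by blast
    next
      case 3
      have "(y l, x l) \<in> even_linked R" using linked[of l] 3 lr by (auto intro: even_linked_sym[OF sym_R])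
      moreover have "2 * q \<le> r - l"
      proof -
        have "s \<le> s * j" using j by simp
        then show ?thesis using s_ge lr by linarith
      qed
      ultimately have "(w l, w r) \<in> R ^^ (r - l)"
        using even_linked_walk[OF finite_V R_subset sym_R _ colouring_walk[OF xc(2) 3(1) _ 3(2)]] lr wr wl 3
        by simp
      then obtain g where g: "g \<in> conf" "\<And>i. i \<notin> ?\<Lambda> \<Longrightarrow> g i = w i"
          "\<And>i. l \<le> i \<Longrightarrow> i < r \<Longrightarrow> (g i, g (i + 1)) \<in> R"
        using patch_walk[OF w 3(1) _ 3(2)] lr by (metis add_lessD1)
      then have "g \<in> hb ?\<Lambda> w" by (auto simp: heat_bath_set_def)
      then show ?thesis by blast
    qed
  qed
  let ?d = "(1 - 1 / real q ^ s) ^ j"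
  let ?lt = "of_bool (1 \<le> l \<and> x l \<noteq> y l) :: real" and ?rt = "of_bool (r \<le> n \<and> x r \<noteq> y r) :: real"
  have "1 \<le> l \<Longrightarrow> (x l, w l) \<in> even_linked R" using linked[of l] wl ln by simp
  then obtain \<kappa>1 where \<kappa>1: "\<kappa>1 \<in> couplings (U ?\<Lambda> x) (U ?\<Lambda> w)"
      "measure_pmf.prob \<kappa>1 (dis {l + s * j..<r}) \<le> ?d * ?lt"
      "measure_pmf.prob \<kappa>1 (dis ?\<Lambda>) \<le> ?lt"
    using left_coupling_indicator[OF xc(1) w r lr j _ wr[symmetric] hb(1) hbw] wl
    by (auto cong: conj_cong)
  have "r \<le> n \<Longrightarrow> (w r, y r) \<in> even_linked R" using linked[of r] wr lr by simp
  then obtain \<kappa>2 where \<kappa>2: "\<kappa>2 \<in> couplings (U ?\<Lambda> w) (U ?\<Lambda> y)"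
      "measure_pmf.prob \<kappa>2 (dis {l<..r - s * j}) \<le> ?d * ?rt"
      "measure_pmf.prob \<kappa>2 (dis ?\<Lambda>) \<le> ?rt"
    using right_coupling_indicator[OF w yc(1) r lr j _ wl hbw hb(2)] wr by auto
  obtain \<kappa> where \<kappa>: "\<kappa> \<in> couplings (U ?\<Lambda> x) (U ?\<Lambda> y)"
    and glue: "\<And>R P Q. (\<And>x y z. R x z \<Longrightarrow> P x y \<or> Q y z) \<Longrightarrow>
      measure_pmf.prob \<kappa> {(x, z). R x z} \<le>
        measure_pmf.prob \<kappa>1 {(x, y). P x y} + measure_pmf.prob \<kappa>2 {(y, z). Q y z}"
    using glue_couplings[OF \<kappa>1(1) \<kappa>2(1)] by blast
  have sum: "measure_pmf.prob \<kappa> (dis {i}) \<le> measure_pmf.prob \<kappa>1 (dis {i}) + measure_pmf.prob \<kappa>2 (dis {i})" for i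
  proof -
    have d: "dis {i} = {(x, y). x i \<noteq> y i}" by (simp add: dis_def)
    show ?thesis unfolding d by (rule glue) metis
  qed
  have k1: "measure_pmf.prob \<kappa>1 (dis {i}) \<le> (if l + s * j \<le> i then \<delta> else 1) * ?lt" if "i \<in> ?\<Lambda>" for i
  proof (cases "l + s * j \<le> i")
    case True
    have "measure_pmf.prob \<kappa>1 (dis {i}) \<le> measure_pmf.prob \<kappa>1 (dis {l + s * j..<r})"
      by (rule measure_pmf.finite_measure_mono) (use True that in \<open>auto simp: dis_def\<close>)
    also have "\<dots> \<le> \<delta> * ?lt" by (rule order_trans[OF \<kappa>1(2)]) (use \<delta> in \<open>auto intro: mult_right_mono\<close>)
    finally show ?thesis using True by simp
  next
    case False
    have "measure_pmf.prob \<kappa>1 (dis {i}) \<le> measure_pmf.prob \<kappa>1 (dis ?\<Lambda>)"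
      by (rule measure_pmf.finite_measure_mono) (use that in \<open>auto simp: dis_def\<close>)
    then show ?thesis using False \<kappa>1(3) by simp
  qed
  have k2: "measure_pmf.prob \<kappa>2 (dis {i}) \<le> (if i \<le> l + s * j then \<delta> else 1) * ?rt" if "i \<in> ?\<Lambda>" for i
  proof (cases "i \<le> l + s * j \<and> r \<le> n")
    case True
    \<comment> \<open>By \<open>r_eq\<close> the point \<open>r - s * j\<close> is
      \<open>l + s * j + 1\<close>, so the region controlled from the right includes the middle
      site.\<close>
    then have "i \<le> r - s * j" using r_eq by linarith
    then have "measure_pmf.prob \<kappa>2 (dis {i}) \<le> measure_pmf.prob \<kappa>2 (dis {l<..r - s * j})"
      by (intro measure_pmf.finite_measure_mono) (use that in \<open>auto simp: dis_def\<close>)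
    also have "\<dots> \<le> \<delta> * ?rt" by (rule order_trans[OF \<kappa>2(2)]) (use \<delta> in \<open>auto intro: mult_right_mono\<close>)
    finally show ?thesis using True by simp
  next
    case False
    have "measure_pmf.prob \<kappa>2 (dis {i}) \<le> measure_pmf.prob \<kappa>2 (dis ?\<Lambda>)"
      by (rule measure_pmf.finite_measure_mono) (use that in \<open>auto simp: dis_def\<close>)
    also note \<kappa>2(3)
    finally show ?thesis using False by auto
  qed
  have out: "measure_pmf.prob \<kappa> (dis {i}) \<le> of_bool (x i \<noteq> y i)" if "i \<notin> ?\<Lambda>" for i
  proof (cases "x i = y i")
    case True
    have "AE z in measure_pmf \<kappa>. z \<notin> dis {i}"
      unfolding AE_measure_pmf_iff
    proof
      fix z assume z: "z \<in> set_pmf \<kappa>"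
      have "fst z \<in> hb ?\<Lambda> x" "snd z \<in> hb ?\<Lambda> y"
        using couplings_support[OF \<kappa> z] hb finite_hb by auto
      then show "z \<notin> dis {i}"
        using hb_outside[OF _ xc(1) that] hb_outside[OF _ yc(1) that] True
        by (auto simp: dis_def case_prod_unfold)
    qed
    then have "measure_pmf.prob \<kappa> (dis {i}) = 0"
      by (simp add: measure_pmf.prob_eq_0)
    then show ?thesis by simp
  qed simp
  show ?thesis
    unfolding heat_bath_proper[OF x \<Lambda> proper] heat_bath_proper[OF y \<Lambda> proper]
  proof (intro bexI[OF _ \<kappa>] allI)
    fix i
    show "measure_pmf.prob \<kappa> (dis {i}) \<le>
       (if i \<in> ?\<Lambda> then (if l + s * j \<le> i then \<delta> else 1) * ?lt + (if i \<le> l + s * j then \<delta> else 1) * ?rt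
        else of_bool (x i \<noteq> y i))"
      using out[of i] order_trans[OF sum[of i] add_mono[OF k1 k2]] by (cases "i \<in> ?\<Lambda>") simp_all
  qed
qed

end

section \<open>Contraction of a scan\<close>

lemma systematic_scan_abs:
  "systematic_scan H n S [] = return_pmf"
  "systematic_scan H n S (\<Lambda> # \<Lambda>s) = (\<lambda>x. bind_pmf (heat_bath H n S \<Lambda> x) (systematic_scan H n S \<Lambda>s))"
  by (simp_all add: fun_eq_iff)

text \<open>The scan is defined by recursion at its first block, whereas the contraction proof adds
  blocks at the end.\<close>

lemma systematic_scan_snoc:
  "systematic_scan H n S (\<Lambda>s @ [\<Lambda>]) =
    (\<lambda>x. bind_pmf (systematic_scan H n S \<Lambda>s x) (heat_bath H n S \<Lambda>))"
  by (induction \<Lambda>s) (simp_all add: systematic_scan_abs bind_return_pmf bind_return_pmf' bind_assoc_pmf)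

context colour_chain begin

lemma scan_support: "x \<in> S \<Longrightarrow> set_pmf (systematic_scan H n S \<Lambda>s x) \<subseteq> S"
proof (induction \<Lambda>s arbitrary: x)
  case (Cons \<Lambda> \<Lambda>s)
  then show ?case using heat_bath_support[OF Cons.prems] by (auto dest!: Cons.IH)
qed simp

lemma scan_stationary:
  "S \<noteq> {} \<Longrightarrow> bind_pmf (pmf_of_set S) (systematic_scan H n S \<Lambda>s) = pmf_of_set S"
proof (induction \<Lambda>s)
  case Nil
  then show ?case by (simp add: systematic_scan_abs bind_return_pmf')
next
  case (Cons \<Lambda> \<Lambda>s)
  have "bind_pmf (pmf_of_set S) (systematic_scan H n S (\<Lambda> # \<Lambda>s)) =
      bind_pmf (bind_pmf (pmf_of_set S) (heat_bath H n S \<Lambda>)) (systematic_scan H n S \<Lambda>s)"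
    by (simp add: systematic_scan_abs bind_assoc_pmf)
  also have "\<dots> = pmf_of_set S"
    unfolding heat_bath_stationary[OF Cons.prems] using Cons by blast
  finally show ?case .
qed

definition disagree :: "((nat \<Rightarrow> 'a) \<times> (nat \<Rightarrow> 'a)) pmf \<Rightarrow> nat \<Rightarrow> real" where
  "disagree \<mu> i = measure_pmf.prob \<mu> (dis {i})"

lemma disagree_bounds: "0 \<le> disagree \<mu> i" "disagree \<mu> i \<le> 1"
  by (simp_all add: disagree_def)

text \<open>The bounds of \<open>block_coupling\<close> are linear in indicators of disagreement, so
  integrating them over \<open>\<mu>\<close> turns indicators into probabilities.\<close>

lemma block_advance:
  fixes \<delta> :: real and l r j :: nat
  assumes \<mu>: "\<mu> \<in> couplings p p'" and supp: "set_pmf p \<subseteq> S" "set_pmf p' \<subseteq> S"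
    and r: "r \<le> n + 1" "l + s * j < r" "r \<le> n \<Longrightarrow> r = l + 2 * (s * j) + 1" and j: "1 \<le> j"
    and \<delta>: "(1 - 1 / real q ^ s) ^ j \<le> \<delta>"
  shows "\<exists>\<mu>'\<in>couplings (bind_pmf p (heat_bath H n S {l<..<r})) (bind_pmf p' (heat_bath H n S {l<..<r})).
    \<forall>i. disagree \<mu>' i \<le>
      (if i \<in> {l<..<r} then (if l + s * j \<le> i then \<delta> else 1) * (if 1 \<le> l then disagree \<mu> l else 0)
         + (if i \<le> l + s * j then \<delta> else 1) * (if r \<le> n then disagree \<mu> r else 0)
       else disagree \<mu> i)"
proof -
  let ?P = "\<lambda>z \<kappa>. \<kappa> \<in> couplings (heat_bath H n S {l<..<r} (fst z)) (heat_bath H n S {l<..<r} (snd z)) \<and>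
    (\<forall>i. measure_pmf.prob \<kappa> (dis {i}) \<le>
       (if i \<in> {l<..<r} then (if l + s * j \<le> i then \<delta> else 1) * of_bool (1 \<le> l \<and> fst z l \<noteq> snd z l)
          + (if i \<le> l + s * j then \<delta> else 1) * of_bool (r \<le> n \<and> fst z r \<noteq> snd z r)
        else of_bool (fst z i \<noteq> snd z i)))"
  define K where "K z = (SOME \<kappa>. ?P z \<kappa>)" for z
  have K: "?P z (K z)" if "z \<in> set_pmf \<mu>" for z
  proof -
    have "fst z \<in> S" "snd z \<in> S" using couplings_support[OF \<mu> that] supp by auto
    then have "\<exists>\<kappa>. ?P z \<kappa>" using block_coupling[OF _ _ r j \<delta>] unfolding Bex_def by blast
    then show ?thesis unfolding K_def by (rule someI_ex)
  qed
  let ?\<mu>' = "bind_pmf \<mu> K"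
  have "?\<mu>' \<in> couplings (bind_pmf p (heat_bath H n S {l<..<r})) (bind_pmf p' (heat_bath H n S {l<..<r}))"
    by (rule bind_couplings[OF \<mu>]) (use K in fastforce)
  moreover have "disagree ?\<mu>' i \<le>
      (if i \<in> {l<..<r} then (if l + s * j \<le> i then \<delta> else 1) * (if 1 \<le> l then disagree \<mu> l else 0)
         + (if i \<le> l + s * j then \<delta> else 1) * (if r \<le> n then disagree \<mu> r else 0)
       else disagree \<mu> i)" for i
  proof -
    define A where "A = (if 1 \<le> l then dis {l} else {} :: ((nat \<Rightarrow> 'a) \<times> (nat \<Rightarrow> 'a)) set)"
    define B where "B = (if r \<le> n then dis {r} else {} :: ((nat \<Rightarrow> 'a) \<times> (nat \<Rightarrow> 'a)) set)"
    define c1 where "c1 = (if l + s * j \<le> i then \<delta> else 1)"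
    define c2 where "c2 = (if i \<le> l + s * j then \<delta> else 1)"
    let ?g = "\<lambda>z. if i \<in> {l<..<r} then c1 * indicator A z + c2 * indicator B z else indicator (dis {i}) z :: real"
    have int: "integrable (measure_pmf \<mu>) (indicator X :: _ \<Rightarrow> real)" for X
      by (rule measure_pmf.integrable_const_bound[where B = 1]) (auto simp: indicator_def)
    have "integrable (measure_pmf \<mu>) (\<lambda>z. c1 * indicator A z + c2 * indicator B z :: real)"
      by (intro Bochner_Integration.integrable_add integrable_mult_right int)
    then have int_g: "integrable (measure_pmf \<mu>) ?g"
      by (cases "i \<in> {l<..<r}") (simp_all only: if_True if_False int)
    have g: "measure_pmf.prob (K z) (dis {i}) \<le> ?g z" if "z \<in> set_pmf \<mu>" for z
    proof -
      have "indicator A z = (of_bool (1 \<le> l \<and> fst z l \<noteq> snd z l) :: real)"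
        "indicator B z = (of_bool (r \<le> n \<and> fst z r \<noteq> snd z r) :: real)"
        "indicator (dis {i}) z = (of_bool (fst z i \<noteq> snd z i) :: real)"
        by (auto simp: A_def B_def dis_def case_prod_unfold)
      then show ?thesis using K[OF that] unfolding c1_def c2_def by presburger
    qed
    have "disagree ?\<mu>' i \<le> measure_pmf.expectation \<mu> ?g"
      unfolding disagree_def
      by (rule measure_pmf_bind_le) (use g int_g in blast)+
    also have "\<dots> = (if i \<in> {l<..<r} then c1 * measure_pmf.prob \<mu> A + c2 * measure_pmf.prob \<mu> B
        else disagree \<mu> i)"
      by (auto simp: disagree_def int Bochner_Integration.integral_add)
    finally show ?thesis unfolding A_def B_def c1_def c2_def by (auto simp: disagree_def split: if_splits)
  qed
  ultimately show ?thesis by blast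
qed

lemma block_eq: "block \<beta> s n k = {k * (s * \<beta>)<..<min ((k + 2) * (s * \<beta>)) n + 1}"
proof -
  have "k * \<beta> * s = k * (s * \<beta>)" "(k + 2) * \<beta> * s = (k + 2) * (s * \<beta>)"
    by (simp_all only: mult.assoc mult.commute[of \<beta> s])
  moreover have "{a + 1..b} = {a<..<b + 1}" for a b :: nat by auto
  ultimately show ?thesis unfolding block_def by (simp only:)
qed

text \<open>Let L = s \<beta>. After \<open>k\<close> blocks, sites up to k L have their final
  bound, k L a better one as the next left boundary site, and sites beyond (k + 1) L are untouched.
  Those in between are left uncontrolled, as the next block redraws them, unless the path ends
  there; the last clause covers that case.\<close>

lemma scan_coupling:
  fixes \<delta> \<eta> D :: real and \<beta> :: nat
  assumes \<mu>: "\<mu> \<in> couplings p p'" and supp: "set_pmf p \<subseteq> S" "set_pmf p' \<subseteq> S"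
    and \<beta>: "1 \<le> \<beta>" and \<delta>: "(1 - 1 / real q ^ s) ^ \<beta> \<le> \<delta>" "0 \<le> \<delta>" "\<delta> \<le> 1"
    and \<eta>: "0 \<le> \<eta>" "\<delta> * (1 + \<eta>) \<le> \<eta>"
    and D: "0 \<le> D" "\<And>i. i \<in> {1..n} \<Longrightarrow> disagree \<mu> i \<le> D"
    and k: "k * (s * \<beta>) \<le> n"
  shows "\<exists>\<mu>'\<in>couplings (bind_pmf p (systematic_scan H n S (map (block \<beta> s n) [0..<k])))
      (bind_pmf p' (systematic_scan H n S (map (block \<beta> s n) [0..<k]))).
    (1 \<le> k \<longrightarrow> disagree \<mu>' (k * (s * \<beta>)) \<le> \<eta> * D) \<and>
    (\<forall>i\<in>{1..n}. (i \<le> k * (s * \<beta>) \<longrightarrow> disagree \<mu>' i \<le> (\<eta> + \<delta>) * D) \<and>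
      (k * (s * \<beta>) + s * \<beta> < i \<or> k = 0 \<longrightarrow> disagree \<mu>' i \<le> D) \<and>
      (1 \<le> k \<and> n < k * (s * \<beta>) + s * \<beta> \<and> k * (s * \<beta>) \<le> i \<longrightarrow> disagree \<mu>' i \<le> \<eta> * D))"
  using k
proof (induction k)
  case 0
  show ?case using \<mu> D(2) by (intro bexI[of _ \<mu>]) (auto simp: systematic_scan_abs bind_return_pmf')
next
  case (Suc k)
  define L where "L = s * \<beta>"
  define l where "l = k * L"
  define r where "r = min ((k + 2) * L) n + 1"
  have L: "0 < L" using s_pos \<beta> by (simp add: L_def)
  have lL: "Suc k * L = l + L" "(k + 2) * L = l + 2 * L" by (auto simp: l_def algebra_simps)
  have n: "l + L \<le> n" using Suc.prems lL(1) unfolding L_def by linarith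
  have blk: "block \<beta> s n k = {l<..<r}" unfolding block_eq l_def r_def L_def ..
  have r: "r \<le> n + 1" "l + L < r" "r \<le> n \<Longrightarrow> r = l + 2 * L + 1"
    using n L unfolding r_def lL by auto
  let ?p = "bind_pmf p (systematic_scan H n S (map (block \<beta> s n) [0..<k]))"
  let ?p' = "bind_pmf p' (systematic_scan H n S (map (block \<beta> s n) [0..<k]))"
  have "k * (s * \<beta>) \<le> n" using n by (simp add: l_def L_def)
  from Suc.IH[OF this] obtain \<nu> where \<nu>: "\<nu> \<in> couplings ?p ?p'"
    and \<nu>l: "1 \<le> k \<Longrightarrow> disagree \<nu> l \<le> \<eta> * D"
    and \<nu>1: "\<And>i. i \<in> {1..n} \<Longrightarrow> i \<le> l \<Longrightarrow> disagree \<nu> i \<le> (\<eta> + \<delta>) * D"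
    and \<nu>2: "\<And>i. i \<in> {1..n} \<Longrightarrow> l + L < i \<Longrightarrow> disagree \<nu> i \<le> D"
    unfolding l_def L_def by blast
  have supp': "set_pmf ?p \<subseteq> S" "set_pmf ?p' \<subseteq> S" using supp scan_support by fastforce+
  let ?dl = "if 1 \<le> l then disagree \<nu> l else 0" and ?dr = "if r \<le> n then disagree \<nu> r else 0"
  obtain \<mu>' where \<mu>': "\<mu>' \<in> couplings (bind_pmf ?p (heat_bath H n S {l<..<r})) (bind_pmf ?p' (heat_bath H n S {l<..<r}))"
    and adv: "\<And>i. disagree \<mu>' i \<le>
      (if i \<in> {l<..<r} then (if l + L \<le> i then \<delta> else 1) * ?dl + (if i \<le> l + L then \<delta> else 1) * ?dr
       else disagree \<nu> i)"
    using block_advance[OF \<nu> supp' r(1) r(2,3)[unfolded L_def] \<beta> \<delta>(1)] unfolding L_def by blast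
  \<comment> \<open>The site \<open>l\<close> was the middle of the previous block, so the induction
    hypothesis gives \<eta> D; the site \<open>r\<close> lies beyond all earlier blocks and still
    has the bound D.\<close>
  have dl: "0 \<le> ?dl" "?dl \<le> \<eta> * D"
    using \<nu>l \<eta>(1) D(1) disagree_bounds[of \<nu> l] by (auto simp: l_def)
  have dr: "0 \<le> ?dr" "?dr \<le> D" "n < l + 2 * L \<Longrightarrow> ?dr = 0"
    using \<nu>2[of r] r D(1) disagree_bounds[of \<nu> r] L by auto
  have mid: "disagree \<mu>' (l + L) \<le> \<eta> * D"
  proof -
    have "disagree \<mu>' (l + L) \<le> \<delta> * ?dl + \<delta> * ?dr" using adv[of "l + L"] r(2) L by simp
    also have "\<dots> \<le> \<delta> * (\<eta> * D) + \<delta> * D"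
      using dl(2) dr(2) \<delta>(2) by (intro add_mono mult_left_mono)
    also have "\<dots> = \<delta> * (1 + \<eta>) * D" by (simp add: algebra_simps)
    also have "\<dots> \<le> \<eta> * D" using \<eta>(2) D(1) by (rule mult_right_mono)
    finally show ?thesis .
  qed
  \<comment> \<open>Origin of the rate \<eta> + \<delta>: in the first half of a block the left
    boundary may contribute its full \<eta> D, while the right one contributes at most \<delta>
    D.\<close>
  have low: "disagree \<mu>' i \<le> (\<eta> + \<delta>) * D" if i: "i \<in> {1..n}" "i \<le> l + L" for i
  proof (cases "i \<le> l")
    case True
    then show ?thesis using adv[of i] \<nu>1[OF i(1)] by simp
  next
    case False
    then have mem: "i \<in> {l<..<r}" using i(2) r(2) by auto
    have "disagree \<mu>' i \<le> (if l + L \<le> i then \<delta> else 1) * ?dl + \<delta> * ?dr"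
      using adv[of i] mem i(2) by simp
    also have "\<dots> \<le> 1 * (\<eta> * D) + \<delta> * D"
      using dl dr(1,2) \<delta>(2,3) by (intro add_mono mult_mono) simp_all
    finally show ?thesis by (simp add: algebra_simps)
  qed
  have high: "disagree \<mu>' i \<le> D" if "i \<in> {1..n}" "l + L + L < i" for i
  proof -
    have "r = l + 2 * L + 1" using that n L unfolding r_def lL by auto
    then have "i \<notin> {l<..<r}" using that(2) by auto
    then show ?thesis using adv[of i] \<nu>2[OF that(1)] that(2) by simp
  qed
  \<comment> \<open>This block runs to the end of the path, so no disagreement enters from the
    right.\<close>
  have last: "disagree \<mu>' i \<le> \<eta> * D" if "i \<in> {1..n}" "n < l + L + L" "l + L \<le> i" for i
  proof -
    have "r = n + 1" using that n unfolding r_def lL by auto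
    then have mem: "i \<in> {l<..<r}" using that(1,3) L by auto
    have "disagree \<mu>' i \<le> \<delta> * ?dl + (if i \<le> l + L then \<delta> else 1) * ?dr"
      using adv[of i] mem that(3) by simp
    also have "?dr = 0" using dr(3) that(2) by simp
    also have "\<delta> * ?dl + (if i \<le> l + L then \<delta> else 1) * 0 \<le> 1 * (\<eta> * D)"
      using dl \<delta>(2,3) mult_mono[of \<delta> 1 ?dl "\<eta> * D"] by simp
    finally show ?thesis by simp
  qed
  have snoc: "bind_pmf p0 (systematic_scan H n S (map (block \<beta> s n) [0..<Suc k])) =
      bind_pmf (bind_pmf p0 (systematic_scan H n S (map (block \<beta> s n) [0..<k]))) (heat_bath H n S {l<..<r})" for p0
    by (simp add: systematic_scan_snoc blk bind_assoc_pmf)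
  show ?case
    unfolding snoc lL(1)[unfolded L_def]
    using \<mu>' mid low high last unfolding L_def by (intro bexI[of _ \<mu>']) auto
qed

text \<open>Fewer than s \<beta> sites follow site m s \<beta>, so the last of the \<open>m\<close>
  blocks reaches site \<open>n\<close>, and the final clause of \<open>scan_coupling\<close> bounds
  the remaining sites.\<close>

lemma scan_contraction:
  fixes \<delta> \<eta> D :: real and \<beta> :: nat
  assumes \<mu>: "\<mu> \<in> couplings p p'" and supp: "set_pmf p \<subseteq> S" "set_pmf p' \<subseteq> S"
    and \<beta>: "1 \<le> \<beta>" and \<delta>: "(1 - 1 / real q ^ s) ^ \<beta> \<le> \<delta>" "0 \<le> \<delta>" "\<delta> \<le> 1"
    and \<eta>: "0 \<le> \<eta>" "\<delta> * (1 + \<eta>) \<le> \<eta>"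
    and D: "0 \<le> D" "\<And>i. i \<in> {1..n} \<Longrightarrow> disagree \<mu> i \<le> D"
    and m: "m = n div (s * \<beta>)" "1 \<le> m"
  shows "\<exists>\<mu>'\<in>couplings (bind_pmf p (fixed_order H n S \<beta> s m)) (bind_pmf p' (fixed_order H n S \<beta> s m)).
    \<forall>i\<in>{1..n}. disagree \<mu>' i \<le> (\<eta> + \<delta>) * D"
proof -
  have "m * (s * \<beta>) \<le> n" using m by simp
  from scan_coupling[OF \<mu> supp \<beta> \<delta> \<eta> D this] obtain \<mu>' where
    "\<mu>' \<in> couplings (bind_pmf p (systematic_scan H n S (map (block \<beta> s n) [0..<m])))
      (bind_pmf p' (systematic_scan H n S (map (block \<beta> s n) [0..<m])))"
    and low: "\<And>i. i \<in> {1..n} \<Longrightarrow> i \<le> m * (s * \<beta>) \<Longrightarrow> disagree \<mu>' i \<le> (\<eta> + \<delta>) * D"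
    and last: "\<And>i. i \<in> {1..n} \<Longrightarrow> n < m * (s * \<beta>) + s * \<beta> \<Longrightarrow> m * (s * \<beta>) \<le> i \<Longrightarrow> disagree \<mu>' i \<le> \<eta> * D"
    using m(2) by blast
  moreover have "n < m * (s * \<beta>) + s * \<beta>"
    unfolding m(1) using s_pos \<beta> dividend_less_div_times[of "s * \<beta>" n] by simp
  moreover have "\<eta> * D \<le> (\<eta> + \<delta>) * D" using \<delta>(2) D(1) by (intro mult_right_mono) auto
  ultimately show ?thesis
    unfolding fixed_order_def[abs_def] by (intro bexI[of _ \<mu>']) (meson linear order_trans)+
qed

text \<open>The second copy starts from the uniform law and, by stationarity, keeps it, so only the
  first marginal changes with \<open>t\<close>.\<close>

lemma power_coupling:
  fixes \<delta> \<eta> :: real and \<beta> :: nat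
  assumes x: "x \<in> S"
    and \<beta>: "1 \<le> \<beta>" and \<delta>: "(1 - 1 / real q ^ s) ^ \<beta> \<le> \<delta>" "0 \<le> \<delta>" "\<delta> \<le> 1"
    and \<eta>: "0 \<le> \<eta>" "\<delta> * (1 + \<eta>) \<le> \<eta>"
    and m: "m = n div (s * \<beta>)" "1 \<le> m"
  shows "set_pmf (kernel_power (fixed_order H n S \<beta> s m) t x) \<subseteq> S \<and>
    (\<exists>\<mu>\<in>couplings (kernel_power (fixed_order H n S \<beta> s m) t x) (pmf_of_set S).
      \<forall>i\<in>{1..n}. disagree \<mu> i \<le> (\<eta> + \<delta>) ^ t)"
proof (induction t)
  case 0
  have "\<exists>\<mu>\<in>couplings (return_pmf x) (pmf_of_set S). \<forall>i\<in>{1..n}. disagree \<mu> i \<le> 1"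
    using pair_pmf_couplings disagree_bounds by blast
  then show ?case using x by (simp add: kernel_power_def)
next
  case (Suc t)
  let ?K = "fixed_order H n S \<beta> s m"
  have S: "S \<noteq> {}" using x by auto
  have step: "kernel_power ?K (Suc t) x = bind_pmf (kernel_power ?K t x) ?K"
    by (simp add: kernel_power_def)
  have stat: "bind_pmf (pmf_of_set S) ?K = pmf_of_set S"
    unfolding fixed_order_def[abs_def] using scan_stationary[OF S] .
  obtain \<mu> where \<mu>: "\<mu> \<in> couplings (kernel_power ?K t x) (pmf_of_set S)"
    "\<And>i. i \<in> {1..n} \<Longrightarrow> disagree \<mu> i \<le> (\<eta> + \<delta>) ^ t" using Suc by blast
  have "0 \<le> (\<eta> + \<delta>) ^ t" using \<delta>(2) \<eta>(1) by simp
  then have "\<exists>\<mu>'\<in>couplings (bind_pmf (kernel_power ?K t x) ?K) (bind_pmf (pmf_of_set S) ?K).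
      \<forall>i\<in>{1..n}. disagree \<mu>' i \<le> (\<eta> + \<delta>) * (\<eta> + \<delta>) ^ t"
    using Suc finite_S S by (intro scan_contraction[OF \<mu>(1) _ _ \<beta> \<delta> \<eta> _ \<mu>(2) m]) auto
  moreover have "set_pmf (bind_pmf (kernel_power ?K t x) ?K) \<subseteq> S"
    using Suc scan_support unfolding fixed_order_def[abs_def] by fastforce
  ultimately show ?case unfolding step stat by simp
qed

section \<open>From disagreement probabilities to the mixing time\<close>

lemma tv_dist_le_disagree:
  fixes D :: real
  assumes \<mu>: "\<mu> \<in> couplings p p'" and supp: "set_pmf p \<subseteq> S" "set_pmf p' \<subseteq> S"
    and D: "\<And>i. i \<in> {1..n} \<Longrightarrow> disagree \<mu> i \<le> D"
  shows "tv_dist S p p' \<le> n * D"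
proof -
  have "tv_dist S p p' \<le> measure_pmf.prob \<mu> {(x, y). x \<noteq> y}"
    using finite_S \<mu> by (rule tv_dist_le_coupling)
  also have "\<dots> \<le> measure_pmf.prob \<mu> (\<Union>i\<in>{1..n}. dis {i})"
  proof (rule measure_pmf.finite_measure_mono_AE)
    show "AE z in measure_pmf \<mu>. z \<in> {(x, y). x \<noteq> y} \<longrightarrow> z \<in> (\<Union>i\<in>{1..n}. dis {i})"
      unfolding AE_measure_pmf_iff
    proof (intro ballI impI)
      fix z assume z: "z \<in> set_pmf \<mu>" "z \<in> {(x, y). x \<noteq> y}"
      then obtain i where i: "fst z i \<noteq> snd z i" by (auto simp: fun_eq_iff)
      have "fst z \<in> conf" "snd z \<in> conf"
        using couplings_support[OF \<mu> z(1)] supp S_conf by auto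
      \<comment> \<open>Configurations are \<open>undefined\<close> off the path, so distinct ones
        differ at some site of it and a union bound over sites suffices.\<close>
      then have "i \<in> {1..n}" using conf_outside i by metis
      then show "z \<in> (\<Union>i\<in>{1..n}. dis {i})" using i by (auto simp: dis_def case_prod_unfold)
    qed
  qed simp
  also have "\<dots> \<le> (\<Sum>i\<in>{1..n}. disagree \<mu> i)"
    unfolding disagree_def by (rule measure_pmf.finite_measure_subadditive_finite) auto
  also have "\<dots> \<le> n * D" using sum_mono[of "{1..n}" "disagree \<mu>" "\<lambda>_. D"] D by simp
  finally show ?thesis .
qed

lemma mixing_time_le:
  fixes \<delta> \<eta> \<epsilon> :: real and \<beta> t :: nat
  assumes \<beta>: "1 \<le> \<beta>" and \<delta>: "(1 - 1 / real q ^ s) ^ \<beta> \<le> \<delta>" "0 \<le> \<delta>" "\<delta> \<le> 1"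
    and \<eta>: "0 \<le> \<eta>" "\<delta> * (1 + \<eta>) \<le> \<eta>"
    and m: "m = n div (s * \<beta>)" "1 \<le> m"
    and t: "0 < t" "n * (\<eta> + \<delta>) ^ t \<le> \<epsilon>"
  shows "fixed_order_mix H n S \<beta> s m \<epsilon> \<le> enat t"
  unfolding fixed_order_mix_def mixing_time_def
proof (rule SUP_least)
  fix x assume x: "x \<in> S"
  then have S: "S \<noteq> {}" by auto
  have "tv_dist S (kernel_power (fixed_order H n S \<beta> s m) t x) (pmf_of_set S) \<le> n * (\<eta> + \<delta>) ^ t"
  proof -
    obtain \<mu> where "\<mu> \<in> couplings (kernel_power (fixed_order H n S \<beta> s m) t x) (pmf_of_set S)"
      "\<And>i. i \<in> {1..n} \<Longrightarrow> disagree \<mu> i \<le> (\<eta> + \<delta>) ^ t"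
      "set_pmf (kernel_power (fixed_order H n S \<beta> s m) t x) \<subseteq> S"
      using power_coupling[OF x \<beta> \<delta> \<eta> m, of t] by blast
    then show ?thesis using finite_S S by (intro tv_dist_le_disagree) auto
  qed
  then show "(INF t\<in>{t. 0 < t \<and> tv_dist S (kernel_power (fixed_order H n S \<beta> s m) t x) (pmf_of_set S) \<le> \<epsilon>}. enat t)
      \<le> enat t"
    using t by (intro INF_lower) auto
qed

end

lemma fixed_order_mix_bound:
  fixes H :: "'c pair_pre_digraph" and N \<epsilon> :: real and n q s \<beta> :: nat
  assumes H: "pair_pseudo_graph H" "Digraph_Component.connected (with_proj H)"
    and S: "is_state_space H n S"
    and q: "q = card (pverts H)" and s: "s = 4 * q + 1"
    and N: "N = 2 * real s * real q ^ s"
    and \<beta>: "\<beta> = nat \<lceil>ln (N + 1)\<rceil> * q ^ s"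
    and m: "m = n div (s * \<beta>)" "1 \<le> m" and \<epsilon>: "0 < \<epsilon>" "\<epsilon> \<le> 1"
  shows "3 \<le> n \<and> (\<exists>t. fixed_order_mix H n S \<beta> s m \<epsilon> \<le> enat t \<and>
    real t \<le> (2 * N + 2) * ln (real n * inverse \<epsilon>))"
proof -
  have path: "colour_path H s" using H by (simp add: colour_path_def s q)
  have q_gt_0: "0 < q" using colour_path.q_pos[OF path] q by simp
  have M: "1 \<le> real q ^ s" using q_gt_0 by simp
  have "2 * 5 * 1 \<le> N" unfolding N using q_gt_0 s M by (intro mult_mono) auto
  then have N10: "10 \<le> N" by simp
  have K: "0 < nat \<lceil>ln (N + 1)\<rceil>" using N10 by simp
  then have \<beta>_pos: "1 \<le> \<beta>" unfolding \<beta> using q_gt_0 by (simp add: Suc_le_eq)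
  \<comment> \<open>One block thus forces n \<ge> 5 > e and hence ln (n / \<epsilon>) \<ge> 1, which
    later absorbs the rounding of \<open>t\<close>.\<close>
  have "5 * 1 \<le> s * \<beta>" using s q_gt_0 \<beta>_pos by (intro mult_le_mono) auto
  moreover have "s * \<beta> \<le> n" using m by (metis div_less not_le not_one_le_zero)
  ultimately have n: "5 \<le> n" by simp
  interpret colour_chain H n s S
    by (intro colour_chain.intro path colour_chain_axioms.intro S) (use n in simp)
  \<comment> \<open>By 1 - x \<le> exp (- x); the factor \<open>q ^ s\<close> in
    \<open>\<beta>\<close> then cancels and leaves the rounded logarithm as exponent.\<close>
  have "(1 - 1 / real q ^ s) ^ \<beta> \<le> exp (- (1 / real q ^ s)) ^ \<beta>"
    using frac_le[of 1 1 1 "real q ^ s"] M exp_ge_add_one_self[of "- (1 / real q ^ s)"]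
    by (intro power_mono) auto
  also have "\<dots> = exp (- real (nat \<lceil>ln (N + 1)\<rceil>))"
    using q_gt_0 by (simp add: exp_of_nat_mult[symmetric] \<beta>)
  also have "\<dots> \<le> exp (- ln (N + 1))"
    by (simp add: of_nat_ceiling)
  also have "\<dots> = 1 / (N + 1)" using N10 by (simp add: exp_minus inverse_eq_divide)
  finally have \<delta>: "(1 - 1 / real (card (pverts H)) ^ s) ^ \<beta> \<le> 1 / (N + 1)" by (simp add: q)
  define t where "t = nat \<lceil>ln (real n * inverse \<epsilon>)\<rceil>"
  have "1 \<le> inverse \<epsilon>" using \<epsilon> by (simp add: one_le_inverse)
  then have "real n * 1 \<le> real n * inverse \<epsilon>" by (intro mult_left_mono) auto
  then have "exp 1 \<le> real n * inverse \<epsilon>" using exp_le n by linarith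
  then have ln_ge: "1 \<le> ln (real n * inverse \<epsilon>)" using n \<epsilon>(1) by (subst ln_ge_iff) auto
  have t_ge: "ln (real n * inverse \<epsilon>) \<le> real t" unfolding t_def by (rule of_nat_ceiling)
  \<comment> \<open>This is \<eta> + \<delta> for \<eta> = 1 / N and \<delta> = 1 / (N + 1), which
    satisfy \<delta> (1 + \<eta>) = \<eta> exactly.\<close>
  have c: "1 / N + 1 / (N + 1) \<le> exp (- 1)"
  proof -
    have "1 / N + 1 / (N + 1) \<le> 1 / 10 + 1 / 10" using N10 by (intro add_mono frac_le) auto
    also have "\<dots> \<le> 1 / 3" by simp
    also have "\<dots> \<le> 1 / exp 1" using exp_le by (intro frac_le) auto
    finally show ?thesis by (simp add: exp_minus inverse_eq_divide)
  qed
  have "real n * (1 / N + 1 / (N + 1)) ^ t \<le> real n * exp (- 1) ^ t"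
    using c N10 by (intro mult_left_mono power_mono) auto
  also have "\<dots> = real n * exp (- real t)" by (simp add: exp_of_nat_mult[symmetric])
  also have "\<dots> \<le> real n * exp (- ln (real n * inverse \<epsilon>))"
    using t_ge by (intro mult_left_mono) auto
  also have "\<dots> = \<epsilon>" using n \<epsilon>(1) by (simp add: exp_minus field_simps)
  finally have dist: "real n * (1 / N + 1 / (N + 1)) ^ t \<le> \<epsilon>" .
  have t_pos: "0 < t" using t_ge ln_ge by (cases t) auto
  have "fixed_order_mix H n S \<beta> s m \<epsilon> \<le> enat t"
    by (rule mixing_time_le[OF \<beta>_pos \<delta> _ _ _ _ m t_pos dist]) (use N10 in \<open>auto simp: field_simps\<close>)
  moreover have "real t \<le> (2 * N + 2) * ln (real n * inverse \<epsilon>)"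
  proof -
    \<comment> \<open>Rounding up costs at most 1, hence at most another ln (n / \<epsilon>), and 2
      \<le> 2 N + 2.\<close>
    have "real t \<le> ln (real n * inverse \<epsilon>) + 1"
      unfolding t_def using ln_ge by linarith
    also have "\<dots> \<le> 2 * ln (real n * inverse \<epsilon>)" using ln_ge by simp
    also have "\<dots> \<le> (2 * N + 2) * ln (real n * inverse \<epsilon>)"
      using N10 ln_ge by (intro mult_right_mono) auto
    finally show ?thesis .
  qed
  ultimately show ?thesis using n by auto
qed

text \<open>Over the naturals, \<open>m2 + 1 = 2 * n div l2\<close> forces at least one block. The
  second conjunct counts heat-bath moves as blocks per scan times scans, for each fixed
  \<open>\<epsilon>\<close>.\<close>

theorem theorem4:
  fixes H :: "'c pair_pre_digraph"
    and \<Omega> :: "nat \<Rightarrow> (nat \<Rightarrow> 'c) set"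
    and q s \<beta> l2 :: nat
  assumes "pair_pseudo_graph H"
    and "Digraph_Component.connected (with_proj H)"
    and "\<And>n. is_state_space H n (\<Omega> n)"
    and "q = card (pverts H)"
    and "s = 4 * q + 1"
    and "\<beta> = nat \<lceil>ln (2 * real s * real q ^ s + 1)\<rceil> * q ^ s"
    and "l2 = 2 * \<beta> * s"
  shows "(\<forall>n m2 \<epsilon>. m2 + 1 = 2 * n div l2 \<longrightarrow> 0 < \<epsilon> \<longrightarrow> \<epsilon> \<le> 1 \<longrightarrow>
            ereal_of_enat (fixed_order_mix H n (\<Omega> n) \<beta> s (m2 + 1) \<epsilon>)
              \<le> ereal ((4 * real s * real q ^ s + 2) * ln (real n * inverse \<epsilon>)))
       \<and> (\<forall>\<epsilon>. 0 < \<epsilon> \<longrightarrow> \<epsilon> \<le> 1 \<longrightarrow>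
            (\<exists>f \<in> O(\<lambda>n. real n * ln (real n)). \<forall>\<^sub>F n in sequentially.
               ereal_of_enat (enat (2 * n div l2)
                   * fixed_order_mix H n (\<Omega> n) \<beta> s (2 * n div l2) \<epsilon>)
                 \<le> ereal (f n)))"
proof (intro conjI allI impI)
  define N where "N = 2 * real s * real q ^ s"
  have N: "4 * real s * real q ^ s + 2 = 2 * N + 2" by (simp add: N_def)
  have N_nonneg: "0 \<le> N" by (simp add: N_def)
  \<comment> \<open>The 2 in \<open>l2\<close> cancels: successive blocks start s \<beta> sites
    apart, half a block length.\<close>
  have div_eq: "2 * n div l2 = n div (s * \<beta>)" for n
    unfolding assms(7) by (simp add: mult.assoc mult.commute[of \<beta> s])
  have bound: "3 \<le> n \<and> (\<exists>t. fixed_order_mix H n (\<Omega> n) \<beta> s (2 * n div l2) \<epsilon> \<le> enat t \<and>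
      real t \<le> (2 * N + 2) * ln (real n * inverse \<epsilon>))"
    if "1 \<le> 2 * n div l2" "0 < \<epsilon>" "\<epsilon> \<le> 1" for n \<epsilon>
    using fixed_order_mix_bound[OF assms(1,2) assms(3) assms(4,5) N_def _ div_eq that]
      assms(6) by (simp add: N_def)
  {
    fix n m2 :: nat and \<epsilon> :: real
    assume m2: "m2 + 1 = 2 * n div l2" and \<epsilon>: "0 < \<epsilon>" "\<epsilon> \<le> 1"
    obtain t where t: "fixed_order_mix H n (\<Omega> n) \<beta> s (m2 + 1) \<epsilon> \<le> enat t"
        "real t \<le> (2 * N + 2) * ln (real n * inverse \<epsilon>)"
      using bound[of n \<epsilon>] m2 \<epsilon> by auto
    have "ereal_of_enat (fixed_order_mix H n (\<Omega> n) \<beta> s (m2 + 1) \<epsilon>) \<le> ereal (real t)"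
      using t(1) by (metis ereal_of_enat_le_iff ereal_of_enat_simps(1))
    also have "\<dots> \<le> ereal ((2 * N + 2) * ln (real n * inverse \<epsilon>))" using t(2) by simp
    finally show "ereal_of_enat (fixed_order_mix H n (\<Omega> n) \<beta> s (m2 + 1) \<epsilon>)
        \<le> ereal ((4 * real s * real q ^ s + 2) * ln (real n * inverse \<epsilon>))"
      unfolding N .
  }
  fix \<epsilon> :: real
  assume \<epsilon>: "0 < \<epsilon>" "\<epsilon> \<le> 1"
  define f where "f n = real n * ((2 * N + 2) * (ln (real n) + ln (inverse \<epsilon>)))" for n
  have e: "0 \<le> ln (inverse \<epsilon>)" using \<epsilon> by (simp add: one_le_inverse)
  have "f \<in> O(\<lambda>n. real n * ln (real n))"
  proof (rule bigoI)
    show "\<forall>\<^sub>F n in sequentially. norm (f n) \<le> (2 * N + 2) * (1 + ln (inverse \<epsilon>)) * norm (real n * ln (real n))"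
      unfolding eventually_sequentially
    proof (intro exI[of _ 3] allI impI)
      fix n :: nat assume n: "3 \<le> n"
      \<comment> \<open>From n \<ge> 3 > e on, the constant ln (1 / \<epsilon>) is at most ln (1 /
        \<epsilon>) ln n.\<close>
      have ln: "1 \<le> ln (real n)" using n exp_le by (subst ln_ge_iff) auto
      have "ln (inverse \<epsilon>) * 1 \<le> ln (inverse \<epsilon>) * ln (real n)" using e ln by (intro mult_left_mono) auto
      then have "ln (real n) + ln (inverse \<epsilon>) \<le> (1 + ln (inverse \<epsilon>)) * ln (real n)"
        by (simp add: algebra_simps)
      then have "f n \<le> real n * ((2 * N + 2) * ((1 + ln (inverse \<epsilon>)) * ln (real n)))"
        unfolding f_def using N_nonneg by (intro mult_left_mono) auto
      moreover have "0 \<le> f n" unfolding f_def using ln e N_nonneg by (intro mult_nonneg_nonneg) auto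
      ultimately show "norm (f n) \<le> (2 * N + 2) * (1 + ln (inverse \<epsilon>)) * norm (real n * ln (real n))"
        using ln by (simp add: mult_ac abs_mult)
    qed
  qed
  moreover have "\<forall>\<^sub>F n in sequentially.
      ereal_of_enat (enat (2 * n div l2) * fixed_order_mix H n (\<Omega> n) \<beta> s (2 * n div l2) \<epsilon>) \<le> ereal (f n)"
    unfolding eventually_sequentially
  proof (intro exI[of _ 1] allI impI)
    fix n :: nat assume n: "1 \<le> n"
    define m where "m = 2 * n div l2"
    have m_le: "m \<le> n" unfolding m_def div_eq by simp
    have f_nonneg: "0 \<le> f n" unfolding f_def using n e N_nonneg by (intro mult_nonneg_nonneg) auto
    show "ereal_of_enat (enat (2 * n div l2) * fixed_order_mix H n (\<Omega> n) \<beta> s (2 * n div l2) \<epsilon>) \<le> ereal (f n)"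
      unfolding m_def[symmetric]
    proof (cases "m = 0")
      \<comment> \<open>Without blocks the chain stands still and its mixing time may be infinite,
        but in \<open>enat\<close> the product with zero is zero.\<close>
      case True
      then show "ereal_of_enat (enat m * fixed_order_mix H n (\<Omega> n) \<beta> s m \<epsilon>) \<le> ereal (f n)"
        using f_nonneg by (simp add: zero_enat_def[symmetric])
    next
      case False
      obtain t where t: "fixed_order_mix H n (\<Omega> n) \<beta> s m \<epsilon> \<le> enat t"
          "real t \<le> (2 * N + 2) * ln (real n * inverse \<epsilon>)"
        using bound[of n \<epsilon>] False \<epsilon> unfolding m_def by auto
      have "enat m * fixed_order_mix H n (\<Omega> n) \<beta> s m \<epsilon> \<le> enat m * enat t"
        using t(1) by (rule mult_left_mono) simp
      then have "ereal_of_enat (enat m * fixed_order_mix H n (\<Omega> n) \<beta> s m \<epsilon>) \<le> ereal (real m * real t)"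
        by (metis ereal_of_enat_le_iff ereal_of_enat_simps(1) of_nat_mult times_enat_simps(1))
      also have "ln (real n * inverse \<epsilon>) = ln (real n) + ln (inverse \<epsilon>)"
        using n \<epsilon>(1) by (intro ln_mult_pos) auto
      then have "real m * real t \<le> f n"
        unfolding f_def using m_le t(2) by (intro mult_mono) auto
      then have "ereal (real m * real t) \<le> ereal (f n)" by simp
      finally show "ereal_of_enat (enat m * fixed_order_mix H n (\<Omega> n) \<beta> s m \<epsilon>) \<le> ereal (f n)" .
    qed
  qed
  ultimately show "\<exists>f\<in>O(\<lambda>n. real n * ln (real n)). \<forall>\<^sub>F n in sequentially.
      ereal_of_enat (enat (2 * n div l2) * fixed_order_mix H n (\<Omega> n) \<beta> s (2 * n div l2) \<epsilon>) \<le> ereal (f n)"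
    by blast
qed

end
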